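(* Consider the stochastic model-based algorithm of the context in the convex setting: the samples are i.i.d., $f(\cdot,\xi)$ is convex for all $\xi\sim\Xi$, $\omega$ is convex and $L_\omega$-Lipschitz on $\operatorname{dom}\omega$, the model satisfies conditions (M) of the context, and the generalized Lipschitz condition (G) holds with constant $L_f$ and growth function $\mathcal{G}$. Let $x^\star$ be an optimal solution, $\alpha>0$, and run the algorithm for $K$ iterations with $\gamma_k=\alpha(\mathcal{G}(\|x^k\|)+1)\sqrt{K}$. Let $\Delta=\|x^1-x^\star\|+\frac{L_f+L_\omega}{\alpha}$. Given $\delta\in(0,1/4)$ and $p\in(2\delta,1)$, with probability at least $1-p$, $(1-2p^{-1}\delta)K$ of the iterates lie in the ball centered at $x^\star$ with radius $\mathsf{R}(\delta)=\delta^{-1}\Delta+\frac{2(L_f+L_\omega)}{\alpha\sqrt{K}}$, and $$\min_{1\le k\le K}\mathbb{E}[\psi(x^k)-\psi(x^\star)]\le\frac{p}{p-2\delta}\cdot\frac{\mathsf{G}_\delta+1}{2\sqrt{K}}\left[\|x^1-x^\star\|^2\alpha+\frac{(L_f+L_\omega)^2}{\alpha}\right],$$ where $\mathsf{G}_\delta=\max\{\mathcal{G}(\|z\|):\|z-x^\star\|\le\delta^{-1}\Delta+\frac{2(L_f+L_\omega)}{\alpha\sqrt{K}}\}$.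
   Context: Problem: minimize over $x\in\mathbb{R}^n$ the function $\psi(x)=f(x)+\omega(x)$, $f(x)=\mathbb{E}_{\xi\sim\Xi}[f(x,\xi)]$, where $f(\cdot,\xi)$ is continuous and convex and $\omega$ is lower semicontinuous, extended-valued, convex and $L_\omega$-Lipschitz on $\operatorname{dom}\omega$. $\mathcal{X}^\star$ is the (nonempty) set of optimal solutions, $x^\star\in\mathcal{X}^\star$. $\|\cdot\|$ is the Euclidean norm. Algorithm: start from a fixed $x^1\in\operatorname{dom}\omega$; for $k=1,2,\dots$ draw $\xi^k\sim\Xi$ (i.i.d.), choose $\gamma_k>0$ and set $x^{k+1}=\arg\min_x\{f_{x^k}(x,\xi^k)+\omega(x)+\frac{\gamma_k}{2}\|x-x^k\|^2\}$, where $f_x(\cdot,\xi)$ is a stochastic model function of $f$ at $x$. (M) $\mathbb{E}_\xi[f_x(x,\xi)]=f(x)$ for all $x\in\operatorname{dom}\omega$; $\mathbb{E}_\xi[f_x(y,\xi)-f(y)]\le0$ for all $x,y\in\operatorname{dom}\omega$; and $f_x(y,\xi)$ is convex in $y$ for all $x,y\in\operatorname{dom}\omega$, $\xi\sim\Xi$. (G) $f_x(y,\xi)-f_x(z,\xi)\le L_f(\xi)\,\mathcal{G}(\|x\|)\,\|y-z\|$ for all $x,y,z$ and $\xi\sim\Xi$, with $\mathbb{E}[L_f(\xi)^2]\le L_f^2$, where the growth function $\mathcal{G}:\mathbb{R}_+\to\mathbb{R}_+$ is continuous and non-decreasing.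
   Formalization: The expectation in the last bound is taken conditionally on some event of probability at least 1-p on which the stated share of iterates lies in the ball; with the total expectation the bound is false, since rare jumps to where the growth function is huge make it arbitrarily large. *)

theory Defs
  imports "HOL-Probability.Probability"
begin

definition edom :: "('a \<Rightarrow> ereal) \<Rightarrow> 'a set" where
  "edom g = {x. g x < \<infinity>}"

definition lsc :: "('a::topological_space \<Rightarrow> ereal) \<Rightarrow> bool" where
  "lsc g \<longleftrightarrow> (\<forall>x c. c < g x \<longrightarrow> (\<forall>\<^sub>F y in nhds x. c < g y))"

text \<open>Only used for functions that never take the value \<open>- \<infinity>\<close>, so the right-hand side is never
  of the form \<open>\<infinity> - \<infinity>\<close>.\<close>

definition econvex :: "('a::real_vector \<Rightarrow> ereal) \<Rightarrow> bool" where
  "econvex g \<longleftrightarrow>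
     (\<forall>x y. \<forall>t\<in>{0<..<1::real}.
        g ((1 - t) *\<^sub>R x + t *\<^sub>R y) \<le> ereal (1 - t) * g x + ereal t * g y)"

definition risk :: "'x measure \<Rightarrow> ('a \<Rightarrow> 'x \<Rightarrow> real) \<Rightarrow> 'a \<Rightarrow> real" where
  "risk \<Xi> f x = (\<integral>\<xi>. f x \<xi> \<partial>\<Xi>)"

definition objective ::
  "'x measure \<Rightarrow> ('a \<Rightarrow> 'x \<Rightarrow> real) \<Rightarrow> ('a \<Rightarrow> ereal) \<Rightarrow> 'a \<Rightarrow> ereal" where
  "objective \<Xi> f \<omega> x = ereal (risk \<Xi> f x) + \<omega> x"

definition solutions ::
  "'x measure \<Rightarrow> ('a \<Rightarrow> 'x \<Rightarrow> real) \<Rightarrow> ('a \<Rightarrow> ereal) \<Rightarrow> 'a set" where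
  "solutions \<Xi> f \<omega> = {x. is_arg_min (objective \<Xi> f \<omega>) (\<lambda>_. True) x}"

text \<open>\<open>m x y \<xi>\<close> is the value at \<open>y\<close> of the stochastic model function built at \<open>x\<close>.  Joint
  measurability and integrability are what makes expectations of the model, also along random
  iterates, meaningful.\<close>

definition stochastic_model ::
  "'x measure \<Rightarrow> ('a::euclidean_space \<Rightarrow> 'x \<Rightarrow> real) \<Rightarrow> ('a \<Rightarrow> ereal) \<Rightarrow>
   ('a \<Rightarrow> 'a \<Rightarrow> 'x \<Rightarrow> real) \<Rightarrow> bool" where
  "stochastic_model \<Xi> f \<omega> m \<longleftrightarrow>
     (\<lambda>(x, y, \<xi>). m x y \<xi>) \<in> borel_measurable (borel \<Otimes>\<^sub>M borel \<Otimes>\<^sub>M \<Xi>) \<and>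
     (\<forall>x\<in>edom \<omega>. \<forall>y\<in>edom \<omega>. integrable \<Xi> (m x y)) \<and>
     (\<forall>x\<in>edom \<omega>. (\<integral>\<xi>. m x x \<xi> \<partial>\<Xi>) = risk \<Xi> f x) \<and>
     (\<forall>x\<in>edom \<omega>. \<forall>y\<in>edom \<omega>. (\<integral>\<xi>. m x y \<xi> - risk \<Xi> f y \<partial>\<Xi>) \<le> 0) \<and>
     (\<forall>x\<in>edom \<omega>. \<forall>\<xi>\<in>space \<Xi>. convex_on (edom \<omega>) (\<lambda>y. m x y \<xi>))"

definition growth_function :: "(real \<Rightarrow> real) \<Rightarrow> bool" where
  "growth_function \<G> \<longleftrightarrow>
     continuous_on {0..} \<G> \<and> mono_on {0..} \<G> \<and> (\<forall>r\<ge>0. 0 \<le> \<G> r)"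

definition generalized_lipschitz ::
  "'x measure \<Rightarrow> ('a::real_normed_vector \<Rightarrow> 'a \<Rightarrow> 'x \<Rightarrow> real) \<Rightarrow> ('x \<Rightarrow> real) \<Rightarrow> real \<Rightarrow>
   (real \<Rightarrow> real) \<Rightarrow> bool" where
  "generalized_lipschitz \<Xi> m l Lf \<G> \<longleftrightarrow>
     (\<forall>\<xi>\<in>space \<Xi>. \<forall>x y z. m x y \<xi> - m x z \<xi> \<le> l \<xi> * \<G> (norm x) * norm (y - z)) \<and>
     l \<in> borel_measurable \<Xi> \<and> integrable \<Xi> (\<lambda>\<xi>. (l \<xi>)\<^sup>2) \<and>
     (\<integral>\<xi>. (l \<xi>)\<^sup>2 \<partial>\<Xi>) \<le> Lf\<^sup>2"

text \<open>The iterates \<open>X 1, X 2, \<dots>\<close> are random variables on \<open>M\<close>.  The subproblem is strongly convex, so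
  its minimizer is unique and the update determines \<open>X (Suc k)\<close>.\<close>

definition model_based_run ::
  "'m measure \<Rightarrow> 'x measure \<Rightarrow> ('a::euclidean_space \<Rightarrow> 'a \<Rightarrow> 'x \<Rightarrow> real) \<Rightarrow> ('a \<Rightarrow> ereal) \<Rightarrow>
   nat \<Rightarrow> (nat \<Rightarrow> 'm \<Rightarrow> 'x) \<Rightarrow> (nat \<Rightarrow> 'm \<Rightarrow> real) \<Rightarrow> 'a \<Rightarrow> (nat \<Rightarrow> 'm \<Rightarrow> 'a) \<Rightarrow> bool" where
  "model_based_run M \<Xi> m \<omega> K \<xi> \<gamma> x1 X \<longleftrightarrow>
     prob_space.indep_vars M (\<lambda>_. \<Xi>) \<xi> {1..K} \<and>
     (\<forall>k\<in>{1..K}. distr M \<Xi> (\<xi> k) = \<Xi>) \<and>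
     (\<forall>s\<in>space M. X 1 s = x1) \<and>
     (\<forall>s\<in>space M. \<forall>k\<in>{1..K}.
        is_arg_min
          (\<lambda>x. ereal (m (X k s) x (\<xi> k s)) + \<omega> x + ereal (\<gamma> k s / 2 * (norm (x - X k s))\<^sup>2))
          (\<lambda>_. True) (X (Suc k) s))"

definition ball_radius :: "real \<Rightarrow> real \<Rightarrow> real \<Rightarrow> nat \<Rightarrow> real \<Rightarrow> real \<Rightarrow> real" where
  "ball_radius Lf L\<omega> \<alpha> K d \<delta> =
     inverse \<delta> * (d + (Lf + L\<omega>) / \<alpha>) + 2 * (Lf + L\<omega>) / (\<alpha> * sqrt (real K))"

text \<open>The supremum is a maximum: a continuous function on a compact set.\<close>

definition max_growth :: "(real \<Rightarrow> real) \<Rightarrow> 'a::euclidean_space \<Rightarrow> real \<Rightarrow> real" where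
  "max_growth \<G> c R = (SUP z\<in>cball c R. \<G> (norm z))"

end

(* Strong convexity of the subproblem bounds |X (k+1) - xstar|^2 pathwise, and integrating over the
   fresh sample gives
     E |X (k+1) - xstar|^2 + E [2 / gamma_k * gap_k] <= E |X k - xstar|^2 + sigma
   with sigma independent of k: the step size gamma_k is proportional to G(|X k|) + 1, which cancels
   the growth of the model.  Telescoping bounds every E |X k - xstar|^2 and the sum of the weighted
   gaps by B = |x1 - xstar|^2 + (Lf + Lomega)^2 / alpha^2.  By Chebyshev each iterate leaves the ball
   with probability at most delta^2, and some k0 has weighted mean gap at most B / K.  The event A
   asks for few iterates outside the ball, X k0 inside it, and all iterates in a much larger ball.
   On A the weight of gap_k0 is controlled by the maximal growth on the ball, and the larger ball only
   serves to make all gaps bounded.  Chebyshev instead of Markov keeps the probability of A above both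
   1 - p and 1 - 2 delta / p. *)

theory Submission
  imports Defs
begin

section \<open>Strongly convex minimization: three-point inequality and measurable
  minimizers\<close>

text \<open>Compare \<open>z\<close> with the points of the segment from \<open>y\<close> to
  \<open>z\<close>. The squared norm contributes an exact strong convexity term there; after
  division by \<open>1 - t\<close> that term carries the factor \<open>t\<close>, and letting
  \<open>t\<close> tend to 1 restores it in full.\<close>

lemma prox_three_point:
  fixes \<phi> :: "'a::real_inner \<Rightarrow> real"
  assumes conv: "convex_on S \<phi>" and z: "z \<in> S" and y: "y \<in> S"
    and min: "\<And>w. w \<in> S \<Longrightarrow> \<phi> z + \<gamma> / 2 * (norm (z - x))\<^sup>2 \<le> \<phi> w + \<gamma> / 2 * (norm (w - x))\<^sup>2"
  shows "\<phi> z + \<gamma> / 2 * (norm (z - x))\<^sup>2 + \<gamma> / 2 * (norm (y - z))\<^sup>2 \<le> \<phi> y + \<gamma> / 2 * (norm (y - x))\<^sup>2"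
proof -
  have "t * (\<gamma> / 2 * (norm (y - z))\<^sup>2)
      \<le> \<phi> y + \<gamma> / 2 * (norm (y - x))\<^sup>2 - (\<phi> z + \<gamma> / 2 * (norm (z - x))\<^sup>2)"
    if t: "0 < t" "t < 1" for t
  proof -
    define w where "w = (1 - t) *\<^sub>R y + t *\<^sub>R z"
    have w: "\<phi> w \<le> (1 - t) * \<phi> y + t * \<phi> z"
      unfolding w_def using conv y z t by (intro convex_onD) auto
    have "w \<in> S"
      unfolding w_def using convex_on_imp_convex[OF conv] y z t by (intro convexD) auto
    \<comment> \<open>This identity is the strong convexity of the squared norm with equality, so
      nothing is lost in the quadratic part.\<close>
    have "(norm ((1 - t) *\<^sub>R a + t *\<^sub>R b))\<^sup>2
        = (1 - t) * (norm a)\<^sup>2 + t * (norm b)\<^sup>2 - t * (1 - t) * (norm (a - b))\<^sup>2" for a b :: 'a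
      unfolding power2_norm_eq_inner
      by (simp add: inner_add_left inner_add_right inner_diff_left inner_diff_right inner_commute[of b a])
        (simp add: algebra_simps)
    from this[of "y - x" "z - x"]
    have "(norm (w - x))\<^sup>2
        = (1 - t) * (norm (y - x))\<^sup>2 + t * (norm (z - x))\<^sup>2 - t * (1 - t) * (norm (y - z))\<^sup>2"
      by (simp add: w_def algebra_simps)
    with min[OF \<open>w \<in> S\<close>] w
    have "\<phi> z + \<gamma> / 2 * (norm (z - x))\<^sup>2 \<le> (1 - t) * \<phi> y + t * \<phi> z + \<gamma> / 2 *
       ((1 - t) * (norm (y - x))\<^sup>2 + t * (norm (z - x))\<^sup>2 - t * (1 - t) * (norm (y - z))\<^sup>2)"
      by simp
    then have "(1 - t) * (t * (\<gamma> / 2 * (norm (y - z))\<^sup>2))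
      \<le> (1 - t) * (\<phi> y + \<gamma> / 2 * (norm (y - x))\<^sup>2 - (\<phi> z + \<gamma> / 2 * (norm (z - x))\<^sup>2))"
      by argo
    then show ?thesis
      using t by (simp only: mult_le_cancel_left_pos diff_gt_0_iff_gt)
  qed
  then have "\<gamma> / 2 * (norm (y - z))\<^sup>2
      \<le> \<phi> y + \<gamma> / 2 * (norm (y - x))\<^sup>2 - (\<phi> z + \<gamma> / 2 * (norm (z - x))\<^sup>2)"
    by (rule field_le_mult_one_interval)
  then show ?thesis by simp
qed

text \<open>Minimizers are given only outcome by outcome, so measurability has to be derived.
  Near-minimizers are chosen measurably from a countable dense subset, and quadratic growth makes
  them converge to the minimizer. At points \<open>p\<close> without such a minimizer the value of
  \<open>\<Phi> p\<close> is irrelevant.\<close>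

lemma measurable_strong_minimizer:
  fixes S :: "'a::euclidean_space set" and H :: "'b \<Rightarrow> 'a \<Rightarrow> real"
  assumes "S \<noteq> {}" and meas: "\<And>y. y \<in> S \<Longrightarrow> (\<lambda>p. H p y) \<in> borel_measurable N"
  obtains \<Phi> where "\<Phi> \<in> borel_measurable N"
    and "\<And>p z c. z \<in> S \<Longrightarrow> continuous_on S (H p) \<Longrightarrow> 0 < c \<Longrightarrow>
           (\<And>y. y \<in> S \<Longrightarrow> H p z + c * (norm (y - z))\<^sup>2 \<le> H p y) \<Longrightarrow> \<Phi> p = z"
proof -
  obtain T where T: "countable T" "T \<subseteq> S" "S \<subseteq> closure T"
    using separable by blast
  with \<open>S \<noteq> {}\<close> have "T \<noteq> {}" by auto
  define d where "d = from_nat_into T"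
  have range_d: "range d = T"
    unfolding d_def using T(1) \<open>T \<noteq> {}\<close> by (rule range_from_nat_into[rotated])
  have d: "d n \<in> S" for n using range_d T(2) by auto
  \<comment> \<open>Only countably many comparisons enter, which makes the first good index
    measurable. The tolerance is \<open>1 / Suc j\<close> so that \<open>j = 0\<close> is
    harmless.\<close>
  define ix where "ix j p = (LEAST n. \<forall>i. H p (d n) \<le> H p (d i) + 1 / Suc j)" for j p
  have [measurable]: "(\<lambda>p. H p (d i)) \<in> borel_measurable N" for i
    using meas d by simp
  have [measurable]: "ix j \<in> measurable N (count_space UNIV)" for j
    unfolding ix_def by measurable
  have "(\<lambda>p. d (ix j p)) \<in> borel_measurable N" for j
    by (rule measurable_compose[of "ix j" N "count_space UNIV" d]) auto
  then have "(\<lambda>p. lim (\<lambda>j. d (ix j p))) \<in> borel_measurable N"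
    by measurable
  moreover have "lim (\<lambda>j. d (ix j p)) = z"
    if z: "z \<in> S" and cont: "continuous_on S (H p)" and c: "0 < c"
      and min: "\<And>y. y \<in> S \<Longrightarrow> H p z + c * (norm (y - z))\<^sup>2 \<le> H p y" for p z c
  proof -
    have approx: "\<exists>n. H p (d n) < H p z + e" if "0 < e" for e
    proof -
      obtain r where "0 < r" and r: "\<And>y. y \<in> S \<Longrightarrow> dist y z < r \<Longrightarrow> dist (H p y) (H p z) < e"
        using cont z \<open>0 < e\<close> unfolding continuous_on_iff by metis
      obtain y where "y \<in> T" "dist y z < r"
        using z T(3) \<open>0 < r\<close> closure_approachable by blast
      then have "H p y < H p z + e" using r[of y] T(2) by (auto simp: dist_real_def)
      then show ?thesis using \<open>y \<in> T\<close> range_d by auto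
    qed
    have lower: "H p z \<le> H p (d i)" for i
      using min[OF d, of i] c by (smt (verit) mult_nonneg_nonneg zero_le_power2)
    \<comment> \<open>The index set behind \<open>LEAST\<close> is nonempty: some dense point comes
      within \<open>1 / Suc j\<close> of the minimum, and no point of \<open>S\<close> lies below
      the minimum.\<close>
    have near: "(norm (d (ix j p) - z))\<^sup>2 \<le> 1 / c * (1 / Suc j)" for j
    proof -
      obtain n where "H p (d n) < H p z + 1 / Suc j" using approx[of "1 / Suc j"] by auto
      then have "\<forall>i. H p (d n) \<le> H p (d i) + 1 / Suc j"
        using lower by (smt (verit))
      then have ix: "\<forall>i. H p (d (ix j p)) \<le> H p (d i) + 1 / Suc j"
        unfolding ix_def by (rule LeastI)
      have "H p (d (ix j p)) \<le> H p z + 1 / Suc j"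
      proof (rule field_le_epsilon)
        fix e :: real assume "0 < e"
        then obtain i where "H p (d i) < H p z + e" using approx by blast
        then show "H p (d (ix j p)) \<le> H p z + 1 / Suc j + e" using ix[rule_format, of i] by simp
      qed
      then have "c * (norm (d (ix j p) - z))\<^sup>2 \<le> 1 / Suc j"
        using min[OF d, of "ix j p"] by linarith
      then show ?thesis using c by (simp add: pos_le_divide_eq mult_ac)
    qed
    have null: "(\<lambda>j. 1 / c * (1 / Suc j)) \<longlonglongrightarrow> 0"
      by (intro tendsto_mult_right_zero LIMSEQ_Suc lim_1_over_n)
    have "(\<lambda>j. (norm (d (ix j p) - z))\<^sup>2) \<longlonglongrightarrow> 0"
      by (rule Lim_null_comparison[OF _ null]) (unfold real_norm_def abs_power2, rule always_eventually, rule allI, rule near)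
    then have "(\<lambda>j. sqrt ((norm (d (ix j p) - z))\<^sup>2)) \<longlonglongrightarrow> sqrt 0"
      by (rule tendsto_real_sqrt)
    then have "(\<lambda>j. d (ix j p)) \<longlonglongrightarrow> z"
      by (simp add: LIM_zero_iff tendsto_norm_zero_iff)
    then show ?thesis by (rule limI)
  qed
  ultimately show ?thesis by (rule that)
qed

section \<open>Independence and random recursions\<close>

text \<open>The joint law is the product law, so Tonelli allows \<open>X\<close> to be frozen while
  \<open>Y\<close> is integrated out.\<close>

lemma (in prob_space) nn_integral_indep_var:
  assumes indep: "indep_var S X N Y" and g[measurable]: "g \<in> borel_measurable (S \<Otimes>\<^sub>M N)"
  shows "(\<integral>\<^sup>+s. g (X s, Y s) \<partial>M) = (\<integral>\<^sup>+s. (\<integral>\<^sup>+y. g (X s, y) \<partial>distr M N Y) \<partial>M)"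
proof -
  have [measurable]: "X \<in> measurable M S" "Y \<in> measurable M N"
    using indep indep_var_rv1 indep_var_rv2 by blast+
  interpret N: prob_space "distr M N Y" by (rule prob_space_distr) measurable
  have "(\<integral>\<^sup>+s. g (X s, Y s) \<partial>M) = (\<integral>\<^sup>+p. g p \<partial>distr M (S \<Otimes>\<^sub>M N) (\<lambda>s. (X s, Y s)))"
    by (subst nn_integral_distr) auto
  also have "\<dots> = (\<integral>\<^sup>+p. g p \<partial>(distr M S X \<Otimes>\<^sub>M distr M N Y))"
    using indep_var_distribution_eq indep by metis
  also have "\<dots> = (\<integral>\<^sup>+x. (\<integral>\<^sup>+y. g (x, y) \<partial>distr M N Y) \<partial>distr M S X)"
    by (subst N.nn_integral_fst[symmetric]) auto
  also have "\<dots> = (\<integral>\<^sup>+s. (\<integral>\<^sup>+y. g (X s, y) \<partial>distr M N Y) \<partial>M)"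
    by (subst nn_integral_distr) (auto intro!: N.borel_measurable_nn_integral)
  finally show ?thesis .
qed

text \<open>By induction \<open>X k\<close> is a measurable function of the samples with index below
  \<open>k\<close>, hence independent of the fresh sample \<open>\<xi> k\<close>. This replaces
  conditional expectations in the descent argument.\<close>

lemma (in prob_space) nn_integral_random_recursion:
  fixes X :: "nat \<Rightarrow> 'a \<Rightarrow> 'b" and \<xi> :: "nat \<Rightarrow> 'a \<Rightarrow> 'c"
  assumes indep: "indep_vars (\<lambda>_. N) \<xi> {1..K}"
    and \<Phi>: "\<Phi> \<in> measurable (S \<Otimes>\<^sub>M N) S" and "x1 \<in> space S"
    and X1: "\<And>s. s \<in> space M \<Longrightarrow> X 1 s = x1"
    and step: "\<And>s k. s \<in> space M \<Longrightarrow> k \<in> {1..K} \<Longrightarrow> X (Suc k) s = \<Phi> (X k s, \<xi> k s)"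
    and k: "k \<in> {1..K}"
  shows "X k \<in> measurable M S"
    and "g \<in> borel_measurable (S \<Otimes>\<^sub>M N) \<Longrightarrow>
      (\<integral>\<^sup>+s. g (X k s, \<xi> k s) \<partial>M) = (\<integral>\<^sup>+s. (\<integral>\<^sup>+u. g (X k s, u) \<partial>distr M N (\<xi> k)) \<partial>M)"
proof -
  have "\<exists>F. F \<in> measurable (Pi\<^sub>M {1..<k} (\<lambda>_. N)) S \<and>
      (\<forall>s\<in>space M. X k s = F (restrict (\<lambda>i. \<xi> i s) {1..<k}))"
    if "1 \<le> k" "k \<le> K" for k
    using that
  proof (induction k rule: dec_induct)
    case base
    show ?case using X1 \<open>x1 \<in> space S\<close> by (intro exI[of _ "\<lambda>_. x1"]) auto
  next
    case (step n)
    from step.prems have "n \<le> K" by simp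
    from step.IH[OF this] obtain F where F: "F \<in> measurable (Pi\<^sub>M {1..<n} (\<lambda>_. N)) S"
      and X: "\<And>s. s \<in> space M \<Longrightarrow> X n s = F (restrict (\<lambda>i. \<xi> i s) {1..<n})"
      by blast
    define J where "J = {1..<Suc n}"
    have J: "{1..<n} \<subseteq> J" "n \<in> J" using step.hyps by (auto simp: J_def)
    have [measurable]: "(\<lambda>w. w n) \<in> measurable (Pi\<^sub>M J (\<lambda>_. N)) N"
      using J by (intro measurable_component_singleton) auto
    have [measurable]: "(\<lambda>w. restrict w {1..<n}) \<in> measurable (Pi\<^sub>M J (\<lambda>_. N)) (Pi\<^sub>M {1..<n} (\<lambda>_. N))"
      by (rule measurable_restrict_subset[OF J(1)])
    have "(\<lambda>w. \<Phi> (F (restrict w {1..<n}), w n)) \<in> measurable (Pi\<^sub>M J (\<lambda>_. N)) S"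
      by (intro measurable_compose[OF _ \<Phi>] measurable_Pair measurable_compose[OF _ F]) measurable
    moreover have "X (Suc n) s = \<Phi> (F (restrict (restrict (\<lambda>i. \<xi> i s) J) {1..<n}),
        restrict (\<lambda>i. \<xi> i s) J n)" if "s \<in> space M" for s
    proof -
      have "restrict (restrict (\<lambda>i. \<xi> i s) J) {1..<n} = restrict (\<lambda>i. \<xi> i s) {1..<n}"
        using J(1) by (auto simp: fun_eq_iff)
      moreover have "restrict (\<lambda>i. \<xi> i s) J n = \<xi> n s"
        using J(2) by simp
      moreover have "X (Suc n) s = \<Phi> (X n s, \<xi> n s)"
        using step.prems step.hyps that by (intro assms(5)) auto
      ultimately show ?thesis using X[OF that] by (simp only:)
    qed
    ultimately show ?case
      unfolding J_def[symmetric]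
      by (intro exI[of _ "\<lambda>w. \<Phi> (F (restrict w {1..<n}), w n)"] conjI ballI)
  qed
  from this[of k] k obtain F where F: "F \<in> measurable (Pi\<^sub>M {1..<k} (\<lambda>_. N)) S"
    and X: "\<And>s. s \<in> space M \<Longrightarrow> X k s = F (restrict (\<lambda>i. \<xi> i s) {1..<k})"
    unfolding atLeastAtMost_iff by blast
  \<comment> \<open>Past and fresh sample are both written as restrictions to disjoint index sets,
    the form in which independence of the family yields independence of a pair.\<close>
  define V where "V s = restrict (\<lambda>i. \<xi> i s) {1..<k}" for s
  define W where "W s = restrict (\<lambda>i. \<xi> i s) {k}" for s
  have ind: "indep_var (Pi\<^sub>M {1..<k} (\<lambda>_. N)) V (Pi\<^sub>M {k} (\<lambda>_. N)) W"
    unfolding V_def W_def using k by (intro indep_var_restrict[OF indep]) auto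
  note [measurable] = F indep_var_rv1[OF ind] indep_var_rv2[OF ind]
  have [measurable]: "(\<lambda>w. w k) \<in> measurable (Pi\<^sub>M {k} (\<lambda>_. N)) N"
    by (rule measurable_component_singleton) simp
  have XV: "X k s = F (V s)" if "s \<in> space M" for s
    using X[OF that] by (simp add: V_def)
  have W: "W s k = \<xi> k s" for s
    by (simp add: W_def)
  show "X k \<in> measurable M S"
    by (subst measurable_cong[OF XV]) measurable
  assume [measurable]: "g \<in> borel_measurable (S \<Otimes>\<^sub>M N)"
  have [measurable]: "\<xi> k \<in> measurable M N"
    using indep k by (simp add: indep_vars_def)
  have gF: "(\<lambda>(v, w). g (F v, w k)) \<in> borel_measurable (Pi\<^sub>M {1..<k} (\<lambda>_. N) \<Otimes>\<^sub>M Pi\<^sub>M {k} (\<lambda>_. N))"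
    by measurable
  have "(\<integral>\<^sup>+s. g (X k s, \<xi> k s) \<partial>M) = (\<integral>\<^sup>+s. (\<lambda>(v, w). g (F v, w k)) (V s, W s) \<partial>M)"
    by (intro nn_integral_cong) (simp add: XV W)
  also have "\<dots> = (\<integral>\<^sup>+s. (\<integral>\<^sup>+w. g (F (V s), w k) \<partial>distr M (Pi\<^sub>M {k} (\<lambda>_. N)) W) \<partial>M)"
    unfolding nn_integral_indep_var[OF ind gF] by simp
  also have "\<dots> = (\<integral>\<^sup>+s. (\<integral>\<^sup>+u. g (X k s, u) \<partial>distr M N (\<xi> k)) \<partial>M)"
  proof (rule nn_integral_cong)
    fix s assume s: "s \<in> space M"
    then have [measurable]: "F (V s) \<in> space S" "X k s \<in> space S"
      using XV[OF s] measurable_space[OF \<open>X k \<in> measurable M S\<close> s] by simp_all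
    have "(\<integral>\<^sup>+w. g (F (V s), w k) \<partial>distr M (Pi\<^sub>M {k} (\<lambda>_. N)) W) = (\<integral>\<^sup>+t. g (F (V s), \<xi> k t) \<partial>M)"
      by (subst nn_integral_distr) (simp_all add: W)
    also have "\<dots> = (\<integral>\<^sup>+u. g (X k s, u) \<partial>distr M N (\<xi> k))"
      by (subst nn_integral_distr) (simp_all add: XV[OF s])
    finally show "(\<integral>\<^sup>+w. g (F (V s), w k) \<partial>distr M (Pi\<^sub>M {k} (\<lambda>_. N)) W)
        = (\<integral>\<^sup>+u. g (X k s, u) \<partial>distr M N (\<xi> k))" .
  qed
  finally show "(\<integral>\<^sup>+s. g (X k s, \<xi> k s) \<partial>M) = (\<integral>\<^sup>+s. (\<integral>\<^sup>+u. g (X k s, u) \<partial>distr M N (\<xi> k)) \<partial>M)" .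
qed

section \<open>Regularity facts on semicontinuity and convexity\<close>

lemma lsc_imp_borel_measurable:
  assumes "lsc g" shows "g \<in> borel_measurable borel"
proof -
  have "open {x. a < g x}" for a
    using assms unfolding lsc_def eventually_nhds
    by (subst open_subopen) (metis (mono_tags, lifting) mem_Collect_eq subsetI)
  then show ?thesis
    unfolding borel_measurable_ereal_iff_Ioi by (auto simp: vimage_def)
qed

lemma convex_on_integral:
  assumes int: "\<And>x. x \<in> S \<Longrightarrow> integrable N (f x)" and "convex S"
    and conv: "\<And>\<xi>. \<xi> \<in> space N \<Longrightarrow> convex_on S (\<lambda>x. f x \<xi>)"
  shows "convex_on S (\<lambda>x. \<integral>\<xi>. f x \<xi> \<partial>N :: real)"
proof (rule convex_onI)
  fix t x y assume t: "0 < t" "t < (1::real)" and S: "x \<in> S" "y \<in> S"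
  then have "(1 - t) *\<^sub>R x + t *\<^sub>R y \<in> S"
    using \<open>convex S\<close> by (intro convexD) auto
  then have "(\<integral>\<xi>. f ((1 - t) *\<^sub>R x + t *\<^sub>R y) \<xi> \<partial>N) \<le> (\<integral>\<xi>. (1 - t) * f x \<xi> + t * f y \<xi> \<partial>N)"
    using int S t by (intro integral_mono) (auto intro!: convex_onD[OF conv])
  also have "\<dots> = (1 - t) * (\<integral>\<xi>. f x \<xi> \<partial>N) + t * (\<integral>\<xi>. f y \<xi> \<partial>N)"
    using int S by simp
  finally show "(\<integral>\<xi>. f ((1 - t) *\<^sub>R x + t *\<^sub>R y) \<xi> \<partial>N)
      \<le> (1 - t) * (\<integral>\<xi>. f x \<xi> \<partial>N) + t * (\<integral>\<xi>. f y \<xi> \<partial>N)" .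
qed (fact \<open>convex S\<close>)

section \<open>The setting of the method and its regularity\<close>

text \<open>The step size \<open>\<gamma>\<close> is a function of the point alone, so that one
  update is a fixed map of the current iterate and the current sample.\<close>

locale model_based_method = prob_space M + sample: prob_space \<Xi>
  for M :: "'m measure" and \<Xi> :: "'x measure" +
  fixes f :: "'a::euclidean_space \<Rightarrow> 'x \<Rightarrow> real"
    and \<omega> :: "'a \<Rightarrow> ereal"
    and m :: "'a \<Rightarrow> 'a \<Rightarrow> 'x \<Rightarrow> real"
    and l :: "'x \<Rightarrow> real" and \<G> :: "real \<Rightarrow> real"
    and Lf L\<omega> \<alpha> :: real and K :: nat
    and \<zeta> :: "nat \<Rightarrow> 'm \<Rightarrow> 'x" and X :: "nat \<Rightarrow> 'm \<Rightarrow> 'a" and x1 xstar :: 'a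
    and \<gamma> :: "'a \<Rightarrow> real"
  defines "\<gamma> \<equiv> \<lambda>x. \<alpha> * (\<G> (norm x) + 1) * sqrt (real K)"
  assumes f_integrable: "\<And>x. integrable \<Xi> (f x)"
    and f_convex: "\<And>\<xi>. \<xi> \<in> space \<Xi> \<Longrightarrow> convex_on UNIV (\<lambda>x. f x \<xi>)"
    and \<omega>_not_MInf: "\<And>x. \<omega> x \<noteq> -\<infinity>" and \<omega>_lsc: "lsc \<omega>" and \<omega>_convex: "econvex \<omega>"
    and \<omega>_lipschitz: "lipschitz_on L\<omega> (edom \<omega>) (\<lambda>x. real_of_ereal (\<omega> x))"
    and model: "stochastic_model \<Xi> f \<omega> m"
    and growth: "growth_function \<G>" and Lf_nonneg: "0 \<le> Lf"
    and model_lipschitz: "generalized_lipschitz \<Xi> m l Lf \<G>"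
    and xstar_solution: "xstar \<in> solutions \<Xi> f \<omega>"
    and x1_edom: "x1 \<in> edom \<omega>" and \<alpha>_pos: "0 < \<alpha>" and K_pos: "1 \<le> K"
    and run: "model_based_run M \<Xi> m \<omega> K \<zeta> (\<lambda>k s. \<gamma> (X k s)) x1 X"
begin

text \<open>Outside the domain, where \<open>\<omega>\<close> is infinite,
  \<open>real_of_ereal\<close> returns 0; hence \<open>w\<close> and \<open>gap\<close> carry
  meaning on \<open>edom \<omega>\<close> only.\<close>

definition w :: "'a \<Rightarrow> real" where "w x = real_of_ereal (\<omega> x)"

definition gap :: "'a \<Rightarrow> real" where "gap x = risk \<Xi> f x + w x - (risk \<Xi> f xstar + w xstar)"

text \<open>The error of one step after the growth factor has cancelled against the step size, and
  therefore the same at every point.\<close>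

definition \<sigma> :: real where "\<sigma> = (Lf + L\<omega>)\<^sup>2 / (\<alpha>\<^sup>2 * K)"

lemma \<omega>_eq: "x \<in> edom \<omega> \<Longrightarrow> \<omega> x = ereal (w x)"
  using \<omega>_not_MInf[of x] by (cases "\<omega> x") (auto simp: edom_def w_def)

lemma growth_nonneg: "0 \<le> \<G> (norm x)"
  using growth by (simp add: growth_function_def)

lemma \<gamma>_pos: "0 < \<gamma> x"
  using growth_nonneg[of x] \<alpha>_pos K_pos by (simp add: \<gamma>_def)

text \<open>One extended-real inequality serves twice: its finite right-hand side makes the domain
  convex, and on the domain it becomes an inequality between reals.\<close>

lemma w_convex: "convex_on (edom \<omega>) w"
proof (rule convex_onI)
  have *: "\<omega> ((1 - t) *\<^sub>R x + t *\<^sub>R y) \<le> ereal ((1 - t) * w x + t * w y)"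
    if "0 < t" "t < 1" "x \<in> edom \<omega>" "y \<in> edom \<omega>" for t x y
  proof -
    have "\<omega> ((1 - t) *\<^sub>R x + t *\<^sub>R y) \<le> ereal (1 - t) * \<omega> x + ereal t * \<omega> y"
      using \<omega>_convex that unfolding econvex_def by simp
    then show ?thesis using that by (simp add: \<omega>_eq)
  qed
  show "convex (edom \<omega>)"
    unfolding convex_alt
  proof (intro ballI allI impI)
    fix x y and u :: real assume xy: "x \<in> edom \<omega>" "y \<in> edom \<omega>" and u: "0 \<le> u \<and> u \<le> 1"
    consider "u = 0" | "u = 1" | "0 < u" "u < 1" using u by linarith
    then show "(1 - u) *\<^sub>R x + u *\<^sub>R y \<in> edom \<omega>"
    proof cases
      case 3
      from *[OF this xy] show ?thesis by (auto simp: edom_def intro: le_less_trans)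
    qed (use xy in auto)
  qed
  fix t x y assume t: "0 < t" "t < (1::real)" and xy: "x \<in> edom \<omega>" "y \<in> edom \<omega>"
  have "(1 - t) *\<^sub>R x + t *\<^sub>R y \<in> edom \<omega>"
    using \<open>convex (edom \<omega>)\<close> xy t by (intro convexD) auto
  with *[OF t xy] show "w ((1 - t) *\<^sub>R x + t *\<^sub>R y) \<le> (1 - t) * w x + t * w y"
    by (simp add: \<omega>_eq)
qed

lemma w_lipschitz: "x \<in> edom \<omega> \<Longrightarrow> y \<in> edom \<omega> \<Longrightarrow> \<bar>w x - w y\<bar> \<le> L\<omega> * norm (x - y)"
  using lipschitz_onD[OF \<omega>_lipschitz, of x y] by (simp add: w_def dist_norm dist_real_def)

lemma L\<omega>_nonneg: "0 \<le> L\<omega>"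
  using \<omega>_lipschitz by (rule lipschitz_on_nonneg)

text \<open>The objective is finite at the starting point, hence also at a minimizer.\<close>

lemma xstar_edom: "xstar \<in> edom \<omega>"
proof -
  have "objective \<Xi> f \<omega> xstar \<le> objective \<Xi> f \<omega> x1"
    using xstar_solution by (auto simp: solutions_def is_arg_min_def not_less)
  moreover have "objective \<Xi> f \<omega> x1 < \<infinity>"
    using \<omega>_eq[OF x1_edom] by (simp add: objective_def)
  ultimately show ?thesis
    unfolding edom_def objective_def by (cases "\<omega> xstar") auto
qed

lemma objective_diff: "x \<in> edom \<omega> \<Longrightarrow> real_of_ereal (objective \<Xi> f \<omega> x - objective \<Xi> f \<omega> xstar) = gap x"
  using xstar_edom by (simp add: objective_def gap_def \<omega>_eq)

lemma gap_nonneg: "x \<in> edom \<omega> \<Longrightarrow> 0 \<le> gap x"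
proof -
  have "objective \<Xi> f \<omega> xstar \<le> objective \<Xi> f \<omega> x"
    using xstar_solution by (auto simp: solutions_def is_arg_min_def not_less)
  then show "0 \<le> gap x" if "x \<in> edom \<omega>"
    using that xstar_edom by (simp add: objective_def gap_def \<omega>_eq)
qed

lemma m_lipschitz:
  assumes "\<xi> \<in> space \<Xi>"
  shows "\<bar>m x y \<xi> - m x z \<xi>\<bar> \<le> l \<xi> * \<G> (norm x) * norm (y - z)"
proof -
  have "m x y \<xi> - m x z \<xi> \<le> l \<xi> * \<G> (norm x) * norm (y - z)"
    and "m x z \<xi> - m x y \<xi> \<le> l \<xi> * \<G> (norm x) * norm (z - y)"
    using model_lipschitz assms unfolding generalized_lipschitz_def by blast+
  then show ?thesis by (simp add: abs_le_iff norm_minus_commute)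
qed

lemma m_measurable: "(\<lambda>(x, y, \<xi>). m x y \<xi>) \<in> borel_measurable (borel \<Otimes>\<^sub>M borel \<Otimes>\<^sub>M \<Xi>)"
  using model by (simp add: stochastic_model_def)

lemma measurable_m [measurable]:
  assumes [measurable]: "a \<in> borel_measurable N" "b \<in> borel_measurable N" "c \<in> measurable N \<Xi>"
  shows "(\<lambda>s. m (a s) (b s) (c s)) \<in> borel_measurable N"
  using measurable_compose[OF _ m_measurable, of "\<lambda>s. (a s, b s, c s)" N] by simp

lemma w_measurable [measurable]: "w \<in> borel_measurable borel"
  unfolding w_def using lsc_imp_borel_measurable[OF \<omega>_lsc] by measurable

lemma growth_continuous: "continuous_on UNIV (\<lambda>x::'a. \<G> (norm x))"
proof -
  have "continuous_on {0..} \<G>" using growth by (simp add: growth_function_def)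
  then show ?thesis
    by (rule continuous_on_compose2[OF _ continuous_on_norm_id]) auto
qed

lemma growth_measurable [measurable]: "(\<lambda>x::'a. \<G> (norm x)) \<in> borel_measurable borel"
  using growth_continuous by (rule borel_measurable_continuous_onI)

lemma \<gamma>_measurable [measurable]: "\<gamma> \<in> borel_measurable borel"
  unfolding \<gamma>_def by measurable

lemma l_measurable [measurable]: "l \<in> borel_measurable \<Xi>"
  using model_lipschitz by (simp add: generalized_lipschitz_def)

text \<open>The risk is a finite convex function on the whole Euclidean space, and such functions
  are continuous.\<close>

lemma risk_continuous: "continuous_on UNIV (risk \<Xi> f)"
  unfolding risk_def using f_integrable f_convex
  by (intro convex_on_continuous convex_on_integral) auto

lemma gap_measurable [measurable]: "gap \<in> borel_measurable borel"
proof -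
  have [measurable]: "risk \<Xi> f \<in> borel_measurable borel"
    using risk_continuous by (rule borel_measurable_continuous_onI)
  show ?thesis unfolding gap_def by measurable
qed

lemma X_1: "s \<in> space M \<Longrightarrow> X 1 s = x1"
  using run by (simp add: model_based_run_def)

lemma \<zeta>_distr: "k \<in> {1..K} \<Longrightarrow> distr M \<Xi> (\<zeta> k) = \<Xi>"
  using run by (simp add: model_based_run_def)

lemma \<zeta>_indep: "indep_vars (\<lambda>_. \<Xi>) \<zeta> {1..K}"
  using run by (simp add: model_based_run_def)

lemma \<zeta>_measurable: "k \<in> {1..K} \<Longrightarrow> \<zeta> k \<in> measurable M \<Xi>"
  using \<zeta>_indep by (simp add: indep_vars_def)

section \<open>The proximal subproblem and measurability of the iterates\<close>

definition prox_obj :: "'a \<Rightarrow> 'x \<Rightarrow> 'a \<Rightarrow> real" where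
  "prox_obj x \<xi> y = m x y \<xi> + w y + \<gamma> x / 2 * (norm (y - x))\<^sup>2"

text \<open>The current iterate is a competitor of finite value, so the minimizer stays in the
  domain and the extended-real subproblem reduces to a real one there.\<close>

lemma X_step:
  assumes s: "s \<in> space M" and k: "k \<in> {1..K}" and Xk: "X k s \<in> edom \<omega>"
  shows "X (Suc k) s \<in> edom \<omega>"
    and "y \<in> edom \<omega> \<Longrightarrow> prox_obj (X k s) (\<zeta> k s) (X (Suc k) s) \<le> prox_obj (X k s) (\<zeta> k s) y"
proof -
  let ?h = "\<lambda>y. ereal (m (X k s) y (\<zeta> k s)) + \<omega> y + ereal (\<gamma> (X k s) / 2 * (norm (y - X k s))\<^sup>2)"
  have min: "?h (X (Suc k) s) \<le> ?h y" for y
    using run s k by (auto simp: model_based_run_def is_arg_min_def not_less)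
  have "?h (X k s) < \<infinity>"
    using \<omega>_eq[OF Xk] by simp
  with min[of "X k s"] have "?h (X (Suc k) s) < \<infinity>"
    by (rule le_less_trans)
  then show "X (Suc k) s \<in> edom \<omega>"
    unfolding edom_def by (cases "\<omega> (X (Suc k) s)") auto
  then show "prox_obj (X k s) (\<zeta> k s) (X (Suc k) s) \<le> prox_obj (X k s) (\<zeta> k s) y" if "y \<in> edom \<omega>"
    using min[of y] that by (simp add: \<omega>_eq prox_obj_def)
qed

lemma X_edom:
  assumes s: "s \<in> space M" and "1 \<le> k" "k \<le> Suc K"
  shows "X k s \<in> edom \<omega>"
  using assms(2,3)
proof (induction k rule: dec_induct)
  case base
  show ?case using x1_edom X_1[OF s] by simp
next
  case (step n)
  then show ?case by (intro X_step(1) s) auto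
qed

lemma X_strong_min:
  assumes s: "s \<in> space M" and k: "k \<in> {1..K}" and y: "y \<in> edom \<omega>"
  shows "prox_obj (X k s) (\<zeta> k s) (X (Suc k) s) + \<gamma> (X k s) / 2 * (norm (y - X (Suc k) s))\<^sup>2
    \<le> prox_obj (X k s) (\<zeta> k s) y"
proof -
  have Xk: "X k s \<in> edom \<omega>" using X_edom s k by simp
  have "\<zeta> k s \<in> space \<Xi>" using \<zeta>_measurable[OF k] s by (rule measurable_space)
  then have "convex_on (edom \<omega>) (\<lambda>y. m (X k s) y (\<zeta> k s) + w y)"
    using model Xk w_convex by (intro convex_on_add) (auto simp: stochastic_model_def)
  from prox_three_point[OF this X_step(1)[OF s k Xk] y, of "\<gamma> (X k s)" "X k s"]
  show ?thesis
    using X_step(2)[OF s k Xk] by (simp add: prox_obj_def)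
qed

text \<open>Strong minimality identifies \<open>X (Suc k)\<close> with a fixed measurable map of
  \<open>X k\<close> and \<open>\<zeta> k\<close>, which brings the run into the form of a random
  recursion.\<close>

lemma
  assumes k: "k \<in> {1..K}"
  shows X_measurable: "X k \<in> borel_measurable M"
    and nn_integral_X_\<zeta>: "h \<in> borel_measurable (borel \<Otimes>\<^sub>M \<Xi>) \<Longrightarrow>
      (\<integral>\<^sup>+s. h (X k s, \<zeta> k s) \<partial>M) = (\<integral>\<^sup>+s. (\<integral>\<^sup>+u. h (X k s, u) \<partial>\<Xi>) \<partial>M)"
proof -
  have "(\<lambda>p. prox_obj (fst p) (snd p) y) \<in> borel_measurable (borel \<Otimes>\<^sub>M \<Xi>)" for y
    unfolding prox_obj_def by measurable
  then obtain \<Phi> where \<Phi>: "\<Phi> \<in> borel_measurable (borel \<Otimes>\<^sub>M \<Xi>)"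
    and min: "\<And>p z c. z \<in> edom \<omega> \<Longrightarrow> continuous_on (edom \<omega>) (prox_obj (fst p) (snd p)) \<Longrightarrow> 0 < c \<Longrightarrow>
       (\<And>y. y \<in> edom \<omega> \<Longrightarrow> prox_obj (fst p) (snd p) z + c * (norm (y - z))\<^sup>2 \<le> prox_obj (fst p) (snd p) y) \<Longrightarrow>
       \<Phi> p = z"
    using measurable_strong_minimizer[of "edom \<omega>" "\<lambda>p. prox_obj (fst p) (snd p)" "borel \<Otimes>\<^sub>M \<Xi>"] x1_edom
    by blast
  have step: "X (Suc k) s = \<Phi> (X k s, \<zeta> k s)" if s: "s \<in> space M" and k: "k \<in> {1..K}" for s k
  proof -
    have \<xi>: "\<zeta> k s \<in> space \<Xi>" using \<zeta>_measurable[OF k] s by (rule measurable_space)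
    have "(l (\<zeta> k s) * \<G> (norm (X k s)))-lipschitz_on UNIV (\<lambda>y. m (X k s) y (\<zeta> k s))"
    proof (rule lipschitz_onI)
      show "dist (m (X k s) y (\<zeta> k s)) (m (X k s) z (\<zeta> k s))
          \<le> l (\<zeta> k s) * \<G> (norm (X k s)) * dist y z" for y z
        using m_lipschitz[OF \<xi>] by (simp add: dist_real_def dist_norm)
      \<comment> \<open>For a unit vector and the origin, the candidate Lipschitz constant itself
        bounds an absolute value and so is nonnegative.\<close>
      obtain b :: 'a where "norm b = 1" using vector_choose_size[of 1] by auto
      with m_lipschitz[OF \<xi>, of "X k s" b 0] show "0 \<le> l (\<zeta> k s) * \<G> (norm (X k s))"
        by simp
    qed
    then have "continuous_on (edom \<omega>) (\<lambda>y. m (X k s) y (\<zeta> k s))"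
      by (meson lipschitz_on_continuous_on continuous_on_subset subset_UNIV)
    moreover have "continuous_on (edom \<omega>) w"
      using lipschitz_on_continuous_on[OF \<omega>_lipschitz] by (simp add: w_def[abs_def])
    ultimately have "continuous_on (edom \<omega>) (prox_obj (X k s) (\<zeta> k s))"
      unfolding prox_obj_def by (intro continuous_intros)
    then show ?thesis
      using X_strong_min[OF s k] X_edom[OF s, of "Suc k"] k \<gamma>_pos[of "X k s"]
      by (intro min[of _ _ "\<gamma> (X k s) / 2", symmetric]) auto
  qed
  note recursion = nn_integral_random_recursion[where X = X and \<xi> = \<zeta>, OF \<zeta>_indep \<Phi> _ X_1 step k]
  show "X k \<in> borel_measurable M"
    by (rule recursion(1)) auto
  show "(\<integral>\<^sup>+s. h (X k s, \<zeta> k s) \<partial>M) = (\<integral>\<^sup>+s. (\<integral>\<^sup>+u. h (X k s, u) \<partial>\<Xi>) \<partial>M)"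
    if "h \<in> borel_measurable (borel \<Otimes>\<^sub>M \<Xi>)"
    using recursion(2)[of h] that \<zeta>_distr[OF k] by simp
qed

section \<open>One-step bound and its expectation at a frozen iterate\<close>

text \<open>A pathwise bound on \<open>(norm (X (Suc k) s - xstar))\<^sup>2\<close> by a function of \<open>X k s\<close> and the fresh
  sample only.  It is nonnegative even at pairs where no minimizer of the subproblem is available,
  so that it can be integrated over \<open>\<Xi>\<close> for a fixed iterate.\<close>

definition dist_bound :: "'a \<Rightarrow> 'x \<Rightarrow> real" where
  "dist_bound x \<xi> = (norm (x - xstar))\<^sup>2 + ((l \<xi> * \<G> (norm x) + L\<omega>) / \<gamma> x)\<^sup>2
     + 2 / \<gamma> x * (m x xstar \<xi> - m x x \<xi> + w xstar - w x)"

text \<open>The Lipschitz bounds on model and regularizer show that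
  \<open>dist_bound x \<xi>\<close> is at least the square of
  \<open>d - c / \<gamma> x\<close>.\<close>

lemma dist_bound_nonneg:
  assumes "x \<in> edom \<omega>" "\<xi> \<in> space \<Xi>"
  shows "0 \<le> dist_bound x \<xi>"
proof -
  define c d where "c = l \<xi> * \<G> (norm x) + L\<omega>" and "d = norm (x - xstar)"
  have "m x x \<xi> - m x xstar \<xi> + w x - w xstar \<le> c * d"
    using m_lipschitz[OF assms(2), of x x xstar] w_lipschitz[OF assms(1) xstar_edom]
    by (simp add: c_def d_def algebra_simps)
  then have "2 / \<gamma> x * (m x x \<xi> - m x xstar \<xi> + w x - w xstar) \<le> 2 / \<gamma> x * (c * d)"
    using \<gamma>_pos[of x] by (intro mult_left_mono) auto
  moreover have "0 \<le> d\<^sup>2 + (c / \<gamma> x)\<^sup>2 - 2 / \<gamma> x * (c * d)"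
    using zero_le_power2[of "d - c / \<gamma> x"] by (simp add: power2_diff mult_ac)
  moreover have "dist_bound x \<xi> = d\<^sup>2 + (c / \<gamma> x)\<^sup>2 - 2 / \<gamma> x * (m x x \<xi> - m x xstar \<xi> + w x - w xstar)"
    unfolding dist_bound_def c_def d_def by (simp add: right_diff_distrib distrib_left)
  ultimately show ?thesis by linarith
qed

text \<open>Apply the three-point inequality at \<open>xstar\<close>, move the model value from the
  new iterate back to the old one by the Lipschitz bounds, and absorb the displacement into the
  proximal term.\<close>

lemma X_dist_bound:
  assumes s: "s \<in> space M" and k: "k \<in> {1..K}"
  shows "(norm (X (Suc k) s - xstar))\<^sup>2 \<le> dist_bound (X k s) (\<zeta> k s)"
proof -
  define x z u g where "x = X k s" and "z = X (Suc k) s" and "u = \<zeta> k s" and "g = \<gamma> x"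
  define c d where "c = l u * \<G> (norm x) + L\<omega>" and "d = norm (z - x)"
  have g: "0 < g" by (simp add: g_def \<gamma>_pos)
  have x: "x \<in> edom \<omega>" and z: "z \<in> edom \<omega>" using X_edom s k by (auto simp: x_def z_def)
  have u: "u \<in> space \<Xi>" unfolding u_def using \<zeta>_measurable[OF k] s by (rule measurable_space)
  have "m x z u + w z + g / 2 * d\<^sup>2 + g / 2 * (norm (xstar - z))\<^sup>2
      \<le> m x xstar u + w xstar + g / 2 * (norm (xstar - x))\<^sup>2"
    using X_strong_min[OF s k xstar_edom] by (simp add: prox_obj_def x_def z_def u_def g_def d_def)
  moreover have "m x x u - m x z u + w x - w z \<le> c * d"
    using m_lipschitz[OF u, of x z x] w_lipschitz[OF z x] by (simp add: c_def d_def algebra_simps)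
  ultimately have "g / 2 * (norm (z - xstar))\<^sup>2 \<le> g / 2 * (norm (x - xstar))\<^sup>2 + (c * d - g / 2 * d\<^sup>2)
      + (m x xstar u - m x x u + w xstar - w x)"
    by (simp add: norm_minus_commute)
  \<comment> \<open>Young's inequality: the left side is a concave quadratic in \<open>d\<close>
    with its maximum at \<open>d = c / g\<close>.\<close>
  moreover have "c * d - g / 2 * d\<^sup>2 \<le> g / 2 * (c / g)\<^sup>2"
  proof -
    have "g / 2 * (c / g)\<^sup>2 - (c * d - g / 2 * d\<^sup>2) = g / 2 * (c / g - d)\<^sup>2"
      using g by (simp add: power2_eq_square field_simps)
    moreover have "0 \<le> g / 2 * (c / g - d)\<^sup>2" using g by simp
    ultimately show ?thesis by linarith
  qed
  ultimately have "g / 2 * (norm (z - xstar))\<^sup>2 \<le> g / 2 * ((norm (x - xstar))\<^sup>2 + (c / g)\<^sup>2)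
      + (m x xstar u - m x x u + w xstar - w x)"
    by (simp add: distrib_left)
  also have "\<dots> = g / 2 * dist_bound x u"
    using g by (simp add: dist_bound_def c_def g_def[symmetric] distrib_left)
  finally show ?thesis
    using g by (simp add: x_def z_def u_def)
qed

lemma
  shows l_integrable: "integrable \<Xi> l" and l_square_integrable: "integrable \<Xi> (\<lambda>\<xi>. (l \<xi>)\<^sup>2)"
    and expectation_l: "(\<integral>\<xi>. l \<xi> \<partial>\<Xi>) \<le> Lf" and expectation_l_square: "(\<integral>\<xi>. (l \<xi>)\<^sup>2 \<partial>\<Xi>) \<le> Lf\<^sup>2"
proof -
  show sq: "integrable \<Xi> (\<lambda>\<xi>. (l \<xi>)\<^sup>2)" and le: "(\<integral>\<xi>. (l \<xi>)\<^sup>2 \<partial>\<Xi>) \<le> Lf\<^sup>2"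
    using model_lipschitz by (auto simp: generalized_lipschitz_def)
  show int: "integrable \<Xi> l"
    using l_measurable sq by (rule sample.square_integrable_imp_integrable)
  \<comment> \<open>Nonnegativity of the variance bounds the squared mean by the second
    moment.\<close>
  have "(\<integral>\<xi>. l \<xi> \<partial>\<Xi>)\<^sup>2 \<le> Lf\<^sup>2"
    using sample.variance_positive[of l] sample.variance_eq[OF int sq] le by simp
  then show "(\<integral>\<xi>. l \<xi> \<partial>\<Xi>) \<le> Lf"
    using Lf_nonneg by (rule power2_le_imp_le)
qed

text \<open>The weight is what remains of the gap after the three-point inequality is divided by
  \<open>\<gamma> x / 2\<close>.\<close>

definition weighted_gap :: "'a \<Rightarrow> real" where "weighted_gap x = 2 / \<gamma> x * gap x"

lemma weighted_gap_nonneg: "x \<in> edom \<omega> \<Longrightarrow> 0 \<le> weighted_gap x"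
  using gap_nonneg[of x] \<gamma>_pos[of x] by (simp add: weighted_gap_def)

lemma weighted_gap_measurable [measurable]: "weighted_gap \<in> borel_measurable borel"
  unfolding weighted_gap_def by measurable

text \<open>On average the model is exact at \<open>x\<close> and does not overestimate the risk at
  \<open>xstar\<close>, so the linear term integrates to at most minus the weighted gap. That gap
  stands on the left because \<open>ennreal\<close> has no negative values.\<close>

lemma expectation_dist_bound:
  assumes x: "x \<in> edom \<omega>"
  shows "(\<integral>\<^sup>+\<xi>. ennreal (dist_bound x \<xi>) \<partial>\<Xi>) + ennreal (weighted_gap x)
    \<le> ennreal ((norm (x - xstar))\<^sup>2) + ennreal \<sigma>"
proof -
  define G where "G = \<G> (norm x)"
  have G: "0 \<le> G" by (simp add: G_def growth_nonneg)
  note [simp] = l_integrable l_square_integrable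
  have [simp]: "integrable \<Xi> (m x x)" "integrable \<Xi> (m x xstar)"
    using model x xstar_edom by (auto simp: stochastic_model_def)
  have mxx: "(\<integral>\<xi>. m x x \<xi> \<partial>\<Xi>) = risk \<Xi> f x" and "(\<integral>\<xi>. m x xstar \<xi> - risk \<Xi> f xstar \<partial>\<Xi>) \<le> 0"
    using model x xstar_edom by (auto simp: stochastic_model_def)
  then have mxs: "(\<integral>\<xi>. m x xstar \<xi> \<partial>\<Xi>) \<le> risk \<Xi> f xstar"
    by (simp add: sample.prob_space)
  have bound_eq: "dist_bound x \<xi> = (norm (x - xstar))\<^sup>2
      + (G\<^sup>2 * (l \<xi>)\<^sup>2 + 2 * G * L\<omega> * l \<xi> + L\<omega>\<^sup>2) / (\<gamma> x)\<^sup>2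
      + 2 / \<gamma> x * (m x xstar \<xi> - m x x \<xi> + w xstar - w x)" for \<xi>
    by (simp add: dist_bound_def G_def power_divide power2_sum power_mult_distrib mult_ac)
  have "integrable \<Xi> (dist_bound x)"
    unfolding bound_eq[abs_def] by simp
  then have "(\<integral>\<^sup>+\<xi>. ennreal (dist_bound x \<xi>) \<partial>\<Xi>) = ennreal (\<integral>\<xi>. dist_bound x \<xi> \<partial>\<Xi>)"
    using dist_bound_nonneg[OF x] by (intro nn_integral_eq_integral) auto
  moreover have "(\<integral>\<xi>. dist_bound x \<xi> \<partial>\<Xi>) = (norm (x - xstar))\<^sup>2
      + (G\<^sup>2 * (\<integral>\<xi>. (l \<xi>)\<^sup>2 \<partial>\<Xi>) + 2 * G * L\<omega> * (\<integral>\<xi>. l \<xi> \<partial>\<Xi>) + L\<omega>\<^sup>2) / (\<gamma> x)\<^sup>2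
      + 2 / \<gamma> x * ((\<integral>\<xi>. m x xstar \<xi> \<partial>\<Xi>) - (\<integral>\<xi>. m x x \<xi> \<partial>\<Xi>) + w xstar - w x)"
    unfolding bound_eq by (simp add: sample.prob_space)
  moreover have "(G\<^sup>2 * (\<integral>\<xi>. (l \<xi>)\<^sup>2 \<partial>\<Xi>) + 2 * G * L\<omega> * (\<integral>\<xi>. l \<xi> \<partial>\<Xi>) + L\<omega>\<^sup>2) / (\<gamma> x)\<^sup>2 \<le> \<sigma>"
  proof -
    have "G\<^sup>2 * (\<integral>\<xi>. (l \<xi>)\<^sup>2 \<partial>\<Xi>) + 2 * G * L\<omega> * (\<integral>\<xi>. l \<xi> \<partial>\<Xi>) + L\<omega>\<^sup>2
        \<le> G\<^sup>2 * Lf\<^sup>2 + 2 * G * L\<omega> * Lf + L\<omega>\<^sup>2"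
      using G L\<omega>_nonneg expectation_l expectation_l_square
      by (intro add_mono mult_left_mono) auto
    also have "\<dots> = (G * Lf + L\<omega>)\<^sup>2"
      by (simp add: power2_sum power_mult_distrib)
    \<comment> \<open>The summand 1 in the step size serves here: the factor \<open>G + 1\<close>
      dominates both the growth of the model and the constant part from
      \<open>L\<omega>\<close>.\<close>
    also have "\<dots> \<le> ((Lf + L\<omega>) * (G + 1))\<^sup>2"
      using G L\<omega>_nonneg Lf_nonneg by (intro power_mono) (auto simp: algebra_simps)
    finally have "(G\<^sup>2 * (\<integral>\<xi>. (l \<xi>)\<^sup>2 \<partial>\<Xi>) + 2 * G * L\<omega> * (\<integral>\<xi>. l \<xi> \<partial>\<Xi>) + L\<omega>\<^sup>2) / (\<gamma> x)\<^sup>2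
        \<le> ((Lf + L\<omega>) * (G + 1))\<^sup>2 / (\<gamma> x)\<^sup>2"
      by (intro divide_right_mono) auto
    also have "\<dots> = \<sigma>"
      using G \<alpha>_pos K_pos unfolding \<sigma>_def \<gamma>_def G_def[symmetric] power_mult_distrib
      by simp
    finally show ?thesis .
  qed
  moreover have "2 / \<gamma> x * ((\<integral>\<xi>. m x xstar \<xi> \<partial>\<Xi>) - (\<integral>\<xi>. m x x \<xi> \<partial>\<Xi>) + w xstar - w x)
      \<le> - weighted_gap x"
  proof -
    have "2 / \<gamma> x * ((\<integral>\<xi>. m x xstar \<xi> \<partial>\<Xi>) - (\<integral>\<xi>. m x x \<xi> \<partial>\<Xi>) + w xstar - w x) \<le> 2 / \<gamma> x * (- gap x)"
      using \<gamma>_pos[of x] mxx mxs by (intro mult_left_mono) (auto simp: gap_def)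
    then show ?thesis by (simp add: weighted_gap_def)
  qed
  moreover have "0 \<le> (\<integral>\<xi>. dist_bound x \<xi> \<partial>\<Xi>)"
    using dist_bound_nonneg[OF x] by (intro integral_nonneg_AE) auto
  moreover have "0 \<le> \<sigma>" by (simp add: \<sigma>_def)
  ultimately show ?thesis
    using weighted_gap_nonneg[OF x] by (simp flip: ennreal_plus add: ennreal_leI)
qed

section \<open>Telescoping the descent inequality\<close>

text \<open>With values in \<open>ennreal\<close>, the descent inequality can be stated and summed
  before any square integrability is known; finiteness comes out of the summation.\<close>

definition mean_sq_dist :: "nat \<Rightarrow> ennreal" where
  "mean_sq_dist k = (\<integral>\<^sup>+s. ennreal ((norm (X k s - xstar))\<^sup>2) \<partial>M)"

definition mean_weighted_gap :: "nat \<Rightarrow> ennreal" where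
  "mean_weighted_gap k = (\<integral>\<^sup>+s. ennreal (weighted_gap (X k s)) \<partial>M)"

text \<open>Integrate the pathwise bound, freeze the current iterate, and insert the expectation
  over the fresh sample.\<close>

lemma descent:
  assumes k: "k \<in> {1..K}"
  shows "mean_sq_dist (Suc k) + mean_weighted_gap k \<le> mean_sq_dist k + ennreal \<sigma>"
proof -
  note [measurable] = X_measurable[OF k] \<zeta>_measurable[OF k]
  have [measurable]: "(\<lambda>(x, \<xi>). ennreal (dist_bound x \<xi>)) \<in> borel_measurable (borel \<Otimes>\<^sub>M \<Xi>)"
    unfolding dist_bound_def by measurable
  \<comment> \<open>Monotonicity of the integral asks for no measurability of
    \<open>X (Suc k)\<close>, so \<open>k = K\<close> is covered as well.\<close>
  have "mean_sq_dist (Suc k) \<le> (\<integral>\<^sup>+s. ennreal (dist_bound (X k s) (\<zeta> k s)) \<partial>M)"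
    unfolding mean_sq_dist_def using X_dist_bound[OF _ k]
    by (intro nn_integral_mono ennreal_leI)
  also have "\<dots> = (\<integral>\<^sup>+s. (\<integral>\<^sup>+u. ennreal (dist_bound (X k s) u) \<partial>\<Xi>) \<partial>M)"
    using nn_integral_X_\<zeta>[OF k, of "\<lambda>(x, \<xi>). ennreal (dist_bound x \<xi>)"] by simp
  finally have "mean_sq_dist (Suc k) + mean_weighted_gap k
      \<le> (\<integral>\<^sup>+s. (\<integral>\<^sup>+u. ennreal (dist_bound (X k s) u) \<partial>\<Xi>) \<partial>M) + mean_weighted_gap k"
    by (rule add_right_mono)
  also have "\<dots> = (\<integral>\<^sup>+s. (\<integral>\<^sup>+u. ennreal (dist_bound (X k s) u) \<partial>\<Xi>) + ennreal (weighted_gap (X k s)) \<partial>M)"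
    unfolding mean_weighted_gap_def by (subst nn_integral_add) auto
  also have "\<dots> \<le> (\<integral>\<^sup>+s. ennreal ((norm (X k s - xstar))\<^sup>2) + ennreal \<sigma> \<partial>M)"
    using k by (intro nn_integral_mono expectation_dist_bound X_edom) auto
  also have "\<dots> = mean_sq_dist k + ennreal \<sigma>"
    unfolding mean_sq_dist_def by (subst nn_integral_add) (auto simp: emeasure_space_1)
  finally show ?thesis .
qed

lemma telescoped_descent:
  "n \<le> K \<Longrightarrow> mean_sq_dist (Suc n) + (\<Sum>k=1..n. mean_weighted_gap k)
    \<le> ennreal ((norm (x1 - xstar))\<^sup>2) + of_nat n * ennreal \<sigma>"
proof (induction n)
  case 0
  have "mean_sq_dist 1 = (\<integral>\<^sup>+s. ennreal ((norm (x1 - xstar))\<^sup>2) \<partial>M)"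
    unfolding mean_sq_dist_def by (intro nn_integral_cong) (simp only: X_1)
  then show ?case by (simp add: emeasure_space_1)
next
  case (Suc n)
  have "mean_sq_dist (Suc (Suc n)) + (\<Sum>k=1..Suc n. mean_weighted_gap k)
      = (mean_sq_dist (Suc (Suc n)) + mean_weighted_gap (Suc n)) + (\<Sum>k=1..n. mean_weighted_gap k)"
    by (simp add: ac_simps)
  also have "\<dots> \<le> (mean_sq_dist (Suc n) + ennreal \<sigma>) + (\<Sum>k=1..n. mean_weighted_gap k)"
    using Suc.prems by (intro add_right_mono descent) auto
  also have "\<dots> = (mean_sq_dist (Suc n) + (\<Sum>k=1..n. mean_weighted_gap k)) + ennreal \<sigma>"
    by (simp add: ac_simps)
  also have "\<dots> \<le> ennreal ((norm (x1 - xstar))\<^sup>2) + of_nat n * ennreal \<sigma> + ennreal \<sigma>"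
    using Suc by (intro add_right_mono) auto
  finally show ?case by (simp add: algebra_simps)
qed

text \<open>The second summand equals \<open>K * \<sigma>\<close>, the error accumulated over the
  whole run.\<close>

definition B :: real where "B = (norm (x1 - xstar))\<^sup>2 + (Lf + L\<omega>)\<^sup>2 / \<alpha>\<^sup>2"

lemma B_nonneg: "0 \<le> B" by (simp add: B_def)

lemma telescoped_bound:
  assumes "n \<le> K"
  shows "mean_sq_dist (Suc n) + (\<Sum>k=1..n. mean_weighted_gap k) \<le> ennreal B"
proof -
  have "0 \<le> \<sigma>" by (simp add: \<sigma>_def)
  then have "ennreal ((norm (x1 - xstar))\<^sup>2) + of_nat n * ennreal \<sigma>
      = ennreal ((norm (x1 - xstar))\<^sup>2 + n * \<sigma>)"
    unfolding ennreal_of_nat_eq_real_of_nat by (subst ennreal_mult[symmetric]) simp_all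
  also have "\<dots> \<le> ennreal ((norm (x1 - xstar))\<^sup>2 + K * \<sigma>)"
    using \<open>0 \<le> \<sigma>\<close> assms by (intro ennreal_leI add_left_mono mult_right_mono) auto
  also have "K * \<sigma> = (Lf + L\<omega>)\<^sup>2 / \<alpha>\<^sup>2"
    using K_pos by (simp add: \<sigma>_def)
  also have "ennreal ((norm (x1 - xstar))\<^sup>2 + (Lf + L\<omega>)\<^sup>2 / \<alpha>\<^sup>2) = ennreal B"
    by (simp only: B_def)
  finally show ?thesis using telescoped_descent[OF assms] by (rule order_trans[rotated])
qed

lemma mean_sq_dist_le:
  assumes k: "k \<in> {1..K}"
  shows "mean_sq_dist k \<le> ennreal B"
proof -
  have "Suc (k - 1) = k" using k by simp
  then have "mean_sq_dist k \<le> mean_sq_dist (Suc (k - 1)) + (\<Sum>j=1..k - 1. mean_weighted_gap j)"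
    by (simp only: le_iff_add) blast
  also have "\<dots> \<le> ennreal B" using k by (intro telescoped_bound) auto
  finally show ?thesis .
qed

lemma sum_mean_weighted_gap_le: "(\<Sum>k=1..K. mean_weighted_gap k) \<le> ennreal B"
proof -
  have "(\<Sum>k=1..K. mean_weighted_gap k) \<le> mean_sq_dist (Suc K) + (\<Sum>k=1..K. mean_weighted_gap k)"
    by (simp only: le_iff_add add.commute) blast
  also have "\<dots> \<le> ennreal B" by (intro telescoped_bound order_refl)
  finally show ?thesis .
qed

section \<open>Tail probabilities and an index of small mean weighted gap\<close>

text \<open>Markov's inequality for the squared distance, whose mean is at most
  \<open>B\<close>.\<close>

lemma prob_far:
  assumes k: "k \<in> {1..K}" and r: "0 < r"
  shows "prob {s \<in> space M. r < norm (X k s - xstar)} \<le> B / r\<^sup>2"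
proof -
  note [measurable] = X_measurable[OF k]
  have "emeasure M {s \<in> space M. r < norm (X k s - xstar)}
      \<le> emeasure M {s \<in> space M. 1 \<le> ennreal (1 / r\<^sup>2) * ennreal ((norm (X k s - xstar))\<^sup>2)}"
  proof (intro emeasure_mono subsetI CollectI)
    fix s assume s: "s \<in> {s \<in> space M. r < norm (X k s - xstar)}"
    then have "r\<^sup>2 \<le> (norm (X k s - xstar))\<^sup>2" using r by (intro power_mono) auto
    then have "ennreal 1 \<le> ennreal (1 / r\<^sup>2 * (norm (X k s - xstar))\<^sup>2)"
      using r by (intro ennreal_leI) simp
    also have "\<dots> = ennreal (1 / r\<^sup>2) * ennreal ((norm (X k s - xstar))\<^sup>2)"
      by (rule ennreal_mult) auto
    finally show "s \<in> space M \<and> 1 \<le> ennreal (1 / r\<^sup>2) * ennreal ((norm (X k s - xstar))\<^sup>2)"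
      using s by simp
  qed measurable
  also have "\<dots> \<le> ennreal (1 / r\<^sup>2) * (\<integral>\<^sup>+s. ennreal ((norm (X k s - xstar))\<^sup>2) * indicator (space M) s \<partial>M)"
    by (rule nn_integral_Markov_inequality) auto
  also have "(\<integral>\<^sup>+s. ennreal ((norm (X k s - xstar))\<^sup>2) * indicator (space M) s \<partial>M) = mean_sq_dist k"
    unfolding mean_sq_dist_def by (intro nn_integral_cong) auto
  also have "ennreal (1 / r\<^sup>2) * \<dots> \<le> ennreal (1 / r\<^sup>2) * ennreal B"
    by (intro mult_left_mono mean_sq_dist_le k) simp
  also have "\<dots> = ennreal (B / r\<^sup>2)"
    using B_nonneg by (subst ennreal_mult[symmetric]) auto
  finally show ?thesis
    using B_nonneg by (simp add: emeasure_eq_measure)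
qed

lemma prob_outside_ball:
  assumes k: "k \<in> {1..K}" and "0 \<le> r" and "0 < \<delta>" and B: "B \<le> (\<delta> * r)\<^sup>2"
  shows "prob {s \<in> space M. X k s \<notin> cball xstar r} \<le> \<delta>\<^sup>2"
proof -
  note [measurable] = X_measurable[OF k]
  have far: "{s \<in> space M. X k s \<notin> cball xstar r} = {s \<in> space M. r < norm (X k s - xstar)}"
    by (auto simp: dist_norm norm_minus_commute)
  show ?thesis
  proof (cases "r = 0")
    \<comment> \<open>Markov's inequality needs a positive radius. For \<open>r = 0\<close> the
      hypothesis forces \<open>B = 0\<close>, and the iterate equals \<open>xstar\<close> almost
      surely.\<close>
    case True
    then have "mean_sq_dist k = 0"
      using mean_sq_dist_le[OF k] B B_nonneg by (simp add: ennreal_neg)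
    then have "AE s in M. ennreal ((norm (X k s - xstar))\<^sup>2) = 0"
      unfolding mean_sq_dist_def by (subst (asm) nn_integral_0_iff_AE) auto
    then have "AE s in M. \<not> r < norm (X k s - xstar)"
      by (rule eventually_mono) (simp add: True)
    then have "prob {s \<in> space M. r < norm (X k s - xstar)} = 0"
      by (subst prob_eq_0) auto
    then show ?thesis unfolding far by simp
  next
    case False
    then have r: "0 < r" using \<open>0 \<le> r\<close> by simp
    have "prob {s \<in> space M. X k s \<notin> cball xstar r} \<le> B / r\<^sup>2"
      unfolding far by (rule prob_far[OF k r])
    also have "\<dots> \<le> \<delta>\<^sup>2"
      using r B by (simp add: power_mult_distrib pos_divide_le_eq)
    finally show ?thesis .
  qed
qed

text \<open>Not all of \<open>K\<close> terms exceed their average. All terms are finite since their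
  sum is, so the strict comparison of sums is carried out in the reals.\<close>

lemma ex_small_mean_weighted_gap: "\<exists>k\<in>{1..K}. mean_weighted_gap k \<le> ennreal (B / K)"
proof (rule ccontr)
  define a where "a k = enn2real (mean_weighted_gap k)" for k
  assume "\<not> ?thesis"
  then have large: "ennreal (B / K) < mean_weighted_gap k" if "k \<in> {1..K}" for k
    using that by (meson not_le)
  have a: "mean_weighted_gap k = ennreal (a k)" if "k \<in> {1..K}" for k
  proof -
    have "mean_weighted_gap k \<le> (\<Sum>k=1..K. mean_weighted_gap k)"
      using that by (intro member_le_sum) auto
    then have "mean_weighted_gap k < top"
      using sum_mean_weighted_gap_le by (meson ennreal_less_top le_less_trans)
    then show ?thesis by (simp add: a_def)
  qed
  have "(\<Sum>k=1..K. ennreal (a k)) = (\<Sum>k=1..K. mean_weighted_gap k)"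
    using a by (intro sum.cong) auto
  then have "(\<Sum>k=1..K. ennreal (a k)) \<le> ennreal B"
    using sum_mean_weighted_gap_le by simp
  moreover have "0 \<le> a k" for k by (simp add: a_def)
  ultimately have "(\<Sum>k=1..K. a k) \<le> B"
    using B_nonneg by (subst (asm) sum_ennreal) (auto simp: ennreal_le_iff)
  moreover have "(\<Sum>k=1..K. B / K) < (\<Sum>k=1..K. a k)"
  proof (rule sum_strict_mono)
    fix k assume k: "k \<in> {1..K}"
    from large[OF k] show "B / K < a k"
      unfolding a[OF k] by (rule contrapos_pp) (simp add: not_less ennreal_leI)
  qed (use K_pos in auto)
  ultimately show False using K_pos by simp
qed

section \<open>From weighted gaps to gaps on a ball\<close>

text \<open>The supremum of a real set is an upper bound once the set is bounded above; compactness
  of the ball provides this.\<close>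

lemma growth_le_max_growth:
  assumes "x \<in> cball xstar r"
  shows "\<G> (norm x) \<le> max_growth \<G> xstar r"
proof -
  have "compact ((\<lambda>z. \<G> (norm z)) ` cball xstar r)"
    by (rule compact_continuous_image[OF continuous_on_subset[OF growth_continuous]]) auto
  then have "bdd_above ((\<lambda>z. \<G> (norm z)) ` cball xstar r)"
    by (intro bounded_imp_bdd_above compact_imp_bounded)
  then show ?thesis
    unfolding max_growth_def using assms by (rule cSUP_upper[rotated])
qed

text \<open>On the ball the step size is bounded by the maximal growth, so the weight can be removed
  at the cost of a constant.\<close>

lemma gap_le_weighted_gap:
  assumes "x \<in> edom \<omega>" "x \<in> cball xstar r"
  shows "gap x \<le> (max_growth \<G> xstar r + 1) * (\<alpha> * sqrt (real K) / 2) * weighted_gap x"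
proof -
  have "\<G> (norm x) \<le> max_growth \<G> xstar r"
    using assms(2) by (rule growth_le_max_growth)
  then have "(\<G> (norm x) + 1) * (\<alpha> * sqrt (real K) / 2) \<le> (max_growth \<G> xstar r + 1) * (\<alpha> * sqrt (real K) / 2)"
    using \<alpha>_pos by (intro mult_right_mono) auto
  then have "\<gamma> x / 2 \<le> (max_growth \<G> xstar r + 1) * (\<alpha> * sqrt (real K) / 2)"
    by (simp add: \<gamma>_def mult_ac)
  then have "\<gamma> x / 2 * weighted_gap x \<le> (max_growth \<G> xstar r + 1) * (\<alpha> * sqrt (real K) / 2) * weighted_gap x"
    using weighted_gap_nonneg[OF assms(1)] by (rule mult_right_mono)
  moreover have "\<gamma> x / 2 * weighted_gap x = gap x"
    using \<gamma>_pos[of x] by (simp add: weighted_gap_def)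
  ultimately show ?thesis by simp
qed

text \<open>The risk is bounded on the ball by compactness, and \<open>w\<close> is controlled by
  its Lipschitz bound relative to \<open>xstar\<close>.\<close>

lemma gap_bounded_on_cball:
  obtains C where "\<And>x. x \<in> edom \<omega> \<Longrightarrow> x \<in> cball xstar r \<Longrightarrow> \<bar>gap x\<bar> \<le> C"
proof -
  have "compact (risk \<Xi> f ` cball xstar r)"
    by (rule compact_continuous_image[OF continuous_on_subset[OF risk_continuous]]) auto
  from compact_imp_bounded[OF this]
  obtain c where c: "\<And>x. x \<in> cball xstar r \<Longrightarrow> \<bar>risk \<Xi> f x\<bar> \<le> c"
    unfolding bounded_iff real_norm_def by blast
  show ?thesis
  proof (rule that[of "c + L\<omega> * r + \<bar>risk \<Xi> f xstar\<bar>"])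
    fix x assume x: "x \<in> edom \<omega>" "x \<in> cball xstar r"
    have "\<bar>w x - w xstar\<bar> \<le> L\<omega> * norm (x - xstar)"
      using x(1) xstar_edom by (rule w_lipschitz)
    also have "\<dots> \<le> L\<omega> * r"
      using x(2) L\<omega>_nonneg by (intro mult_left_mono) (auto simp: dist_norm norm_minus_commute)
    finally show "\<bar>gap x\<bar> \<le> c + L\<omega> * r + \<bar>risk \<Xi> f xstar\<bar>"
      using c[OF x(2)] by (simp add: gap_def)
  qed
qed

text \<open>Conditioning divides the integral over \<open>A\<close> by its probability. Since the
  weighted gap is nonnegative, its integral over \<open>A\<close> is at most the unconditional
  mean.\<close>

lemma integral_uniform_gap_le:
  assumes A: "A \<in> events" and k: "k \<in> {1..K}" and q: "0 < q" "q \<le> prob A"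
    and ball: "\<And>s. s \<in> A \<Longrightarrow> X k s \<in> cball xstar r"
    and small: "mean_weighted_gap k \<le> ennreal (B / K)" and "0 \<le> r"
  shows "(\<integral>s. gap (X k s) \<partial>uniform_measure M A)
    \<le> (max_growth \<G> xstar r + 1) * (\<alpha> * sqrt (real K) / 2) * (B / K) / q"
proof -
  note [measurable] = X_measurable[OF k] A
  define c where "c = (max_growth \<G> xstar r + 1) * (\<alpha> * sqrt (real K) / 2)"
  have in_space: "s \<in> space M" if "s \<in> A" for s using that A by (rule sets.sets_into_space[THEN subsetD, rotated])
  have dom: "X k s \<in> edom \<omega>" if "s \<in> space M" for s using X_edom that k by simp
  have le: "gap (X k s) \<le> c * weighted_gap (X k s)" if "s \<in> A" for s
    unfolding c_def using dom[OF in_space[OF that]] ball[OF that] by (rule gap_le_weighted_gap)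
  have "0 \<le> max_growth \<G> xstar r"
    using growth_le_max_growth[of xstar r] growth_nonneg[of xstar] \<open>0 \<le> r\<close> by simp
  then have c: "0 \<le> c"
    using \<alpha>_pos by (simp add: c_def)
  have "(\<integral>\<^sup>+s. ennreal (gap (X k s)) * indicator A s \<partial>M) \<le> (\<integral>\<^sup>+s. ennreal c * ennreal (weighted_gap (X k s)) \<partial>M)"
  proof (rule nn_integral_mono)
    fix s assume "s \<in> space M"
    show "ennreal (gap (X k s)) * indicator A s \<le> ennreal c * ennreal (weighted_gap (X k s))"
    proof (cases "s \<in> A")
      case True
      then show ?thesis
        using le[OF True] c weighted_gap_nonneg[OF dom[OF \<open>s \<in> space M\<close>]]
        by (subst ennreal_mult[symmetric]) (auto intro: ennreal_leI)
    qed simp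
  qed
  also have "\<dots> = ennreal c * mean_weighted_gap k"
    unfolding mean_weighted_gap_def by (rule nn_integral_cmult) measurable
  also have "\<dots> \<le> ennreal c * ennreal (B / K)"
    using small by (rule mult_left_mono) simp
  also have "\<dots> = ennreal (c * (B / K))"
    using c B_nonneg by (subst ennreal_mult[symmetric]) auto
  finally have *: "(\<integral>\<^sup>+s. ennreal (gap (X k s)) * indicator A s \<partial>M) \<le> ennreal (c * (B / K))" .
  have "(\<integral>\<^sup>+s. ennreal (gap (X k s)) \<partial>uniform_measure M A)
      = (\<integral>\<^sup>+s. ennreal (gap (X k s)) * indicator A s \<partial>M) / emeasure M A"
    by (rule nn_integral_uniform_measure) measurable
  also have "\<dots> \<le> ennreal (c * (B / K)) / ennreal (prob A)"
    unfolding emeasure_eq_measure using * by (rule divide_right_mono_ennreal)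
  also have "\<dots> = ennreal (c * (B / K) / prob A)"
    using c B_nonneg q by (intro divide_ennreal) auto
  also have "\<dots> \<le> ennreal (c * (B / K) / q)"
    using c B_nonneg q by (intro ennreal_leI divide_left_mono mult_pos_pos mult_nonneg_nonneg) auto
  finally have **: "(\<integral>\<^sup>+s. ennreal (gap (X k s)) \<partial>uniform_measure M A) \<le> ennreal (c * (B / K) / q)" .
  \<comment> \<open>The gap is nonnegative along every path, so this identity requires measurability
    only.\<close>
  have "(\<integral>s. gap (X k s) \<partial>uniform_measure M A) = enn2real (\<integral>\<^sup>+s. ennreal (gap (X k s)) \<partial>uniform_measure M A)"
    by (rule integral_eq_nn_integral) (auto simp: measurable_cong_sets[OF sets_uniform_measure refl] intro!: AE_I2 gap_nonneg dom)
  also have "\<dots> \<le> c * (B / K) / q"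
    using ** c B_nonneg q by (intro enn2real_leI) auto
  finally show ?thesis by (simp add: c_def)
qed

section \<open>The good event and the final bound\<close>

text \<open>A union bound over three failures: too many iterates outside the ball costs
  \<open>\<delta> * p / 2\<close>, iterate \<open>k0\<close> outside it at most
  \<open>\<delta> * p / 2\<close>, and any iterate beyond radius \<open>t\<close> at most
  \<open>\<delta> * p / 4\<close>.\<close>

lemma ex_good_event:
  assumes \<delta>: "0 < \<delta>" "\<delta> < 1/4" and p: "2 * \<delta> < p" "p < 1"
    and "0 \<le> r" and B: "B \<le> (\<delta> * r)\<^sup>2" and k0: "k0 \<in> {1..K}"
  obtains A t where "A \<in> events" "1 - 5 / 4 * \<delta> * p \<le> prob A"
    and "\<And>s. s \<in> A \<Longrightarrow>
      (1 - 2 * inverse p * \<delta>) * real K \<le> real (card {k\<in>{1..K}. X k s \<in> cball xstar r})"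
    and "\<And>s. s \<in> A \<Longrightarrow> X k0 s \<in> cball xstar r"
    and "\<And>s k. s \<in> A \<Longrightarrow> k \<in> {1..K} \<Longrightarrow> X k s \<in> cball xstar t"
proof -
  have p0: "0 < p" using \<delta> p by simp
  define bad where "bad k = {s \<in> space M. X k s \<notin> cball xstar r}" for k
  define N where "N s = (\<Sum>k=1..K. indicat_real (bad k) s)" for s
  \<comment> \<open>The number of iterates that may lie outside the ball.\<close>
  define c where "c = 2 * inverse p * \<delta> * real K"
  \<comment> \<open>Chosen so that \<open>K * B / t^2\<close> is at most
    \<open>\<delta> * p / 4\<close>; the summand 1 keeps \<open>t\<close> positive when
    \<open>B = 0\<close>.\<close>
  define t where "t = sqrt (4 * K * B / (\<delta> * p) + 1)"
  define far where "far k = {s \<in> space M. t < norm (X k s - xstar)}" for k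
  have bad_ev: "bad k \<in> events" and far_ev: "far k \<in> events" if "k \<in> {1..K}" for k
  proof -
    note [measurable] = X_measurable[OF that]
    show "bad k \<in> events"
      unfolding bad_def mem_cball dist_norm by measurable
    show "far k \<in> events"
      unfolding far_def by measurable
  qed
  have c: "0 < c" using \<delta> p0 K_pos by (simp add: c_def)
  have bad: "prob (bad k) \<le> \<delta>\<^sup>2" if "k \<in> {1..K}" for k
    unfolding bad_def using that \<open>0 \<le> r\<close> \<delta>(1) B by (rule prob_outside_ball)
  have arg: "0 < 4 * K * B / (\<delta> * p) + 1"
    using \<delta> p0 B_nonneg by (intro add_nonneg_pos) auto
  then have t: "0 < t" "t\<^sup>2 = 4 * K * B / (\<delta> * p) + 1" by (simp_all add: t_def)
  have far: "prob (far k) \<le> B / t\<^sup>2" if "k \<in> {1..K}" for k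
    unfolding far_def using that t(1) by (rule prob_far)
  have N_int: "integrable M N"
    unfolding N_def using bad_ev by (intro Bochner_Integration.integrable_sum integrable_real_indicator) (auto simp: emeasure_eq_measure)
  have N_meas[measurable]: "N \<in> borel_measurable M" using N_int by (rule borel_measurable_integrable)
  have "(\<integral>s. N s \<partial>M) = (\<Sum>k=1..K. prob (bad k))"
    unfolding N_def using bad_ev
    by (subst Bochner_Integration.integral_sum) (auto simp: emeasure_eq_measure Int_absorb2 sets.sets_into_space intro!: sum.cong integrable_real_indicator)
  also have "\<dots> \<le> (\<Sum>k=1..K. \<delta>\<^sup>2)"
    using bad by (rule sum_mono)
  also have "\<dots> = K * \<delta>\<^sup>2" by simp
  finally have EN: "(\<integral>s. N s \<partial>M) \<le> K * \<delta>\<^sup>2" .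
  \<comment> \<open>Markov for the count \<open>N\<close>: its mean is at most
    \<open>K * \<delta>^2\<close>, the second factor \<open>\<delta>\<close> being the gain from
    squared distances.\<close>
  have "prob {s \<in> space M. c \<le> N s} \<le> (\<integral>s. N s \<partial>M) / c"
    using N_int sets.empty_sets _ c
    by (rule integral_Markov_inequality_measure) (auto simp: N_def intro!: sum_nonneg)
  also have "\<dots> \<le> K * \<delta>\<^sup>2 / c"
    using EN c by (intro divide_right_mono) auto
  also have "\<dots> = \<delta> * p / 2"
    using \<delta> p0 K_pos by (simp add: c_def power2_eq_square field_simps)
  finally have many: "prob {s \<in> space M. c \<le> N s} \<le> \<delta> * p / 2" .
  define A where "A = space M - ({s \<in> space M. c \<le> N s} \<union> bad k0 \<union> (\<Union>k\<in>{1..K}. far k))"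
  have far_un: "(\<Union>k\<in>{1..K}. far k) \<in> events" using far_ev by auto
  have many_ev: "{s \<in> space M. c \<le> N s} \<in> events" by measurable
  have "prob (\<Union>k\<in>{1..K}. far k) \<le> (\<Sum>k=1..K. prob (far k))"
    using far_ev by (intro finite_measure_subadditive_finite) auto
  also have "\<dots> \<le> (\<Sum>k=1..K. B / t\<^sup>2)"
    using far by (rule sum_mono)
  also have "\<dots> = K * B / t\<^sup>2" by simp
  also have "\<dots> \<le> \<delta> * p / 4"
  proof -
    have "\<delta> * p / 4 * t\<^sup>2 = K * B + \<delta> * p / 4"
      using \<delta> p0 unfolding t(2) by (simp add: distrib_left)
    then have "K * B \<le> \<delta> * p / 4 * t\<^sup>2" using \<delta> p0 by simp
    then show ?thesis using t(1) by (simp add: pos_divide_le_eq)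
  qed
  finally have fars: "prob (\<Union>k\<in>{1..K}. far k) \<le> \<delta> * p / 4" .
  have "prob (({s \<in> space M. c \<le> N s} \<union> bad k0) \<union> (\<Union>k\<in>{1..K}. far k))
      \<le> prob ({s \<in> space M. c \<le> N s} \<union> bad k0) + prob (\<Union>k\<in>{1..K}. far k)"
    using many_ev bad_ev[OF k0] far_un by (intro measure_Un_le) auto
  also have "prob ({s \<in> space M. c \<le> N s} \<union> bad k0) \<le> prob {s \<in> space M. c \<le> N s} + prob (bad k0)"
    using many_ev bad_ev[OF k0] by (intro measure_Un_le) auto
  finally have "prob (({s \<in> space M. c \<le> N s} \<union> bad k0) \<union> (\<Union>k\<in>{1..K}. far k))
      \<le> \<delta> * p / 2 + \<delta>\<^sup>2 + \<delta> * p / 4"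
    using many bad[OF k0] fars by linarith
  \<comment> \<open>This is where \<open>2 * \<delta> < p\<close> keeps the cost of the single index
    \<open>k0\<close> within the budget.\<close>
  moreover have "\<delta>\<^sup>2 \<le> \<delta> * p / 2"
    using \<delta> p by (simp add: power2_eq_square)
  moreover have "prob A = 1 - prob (({s \<in> space M. c \<le> N s} \<union> bad k0) \<union> (\<Union>k\<in>{1..K}. far k))"
    unfolding A_def using many_ev bad_ev[OF k0] far_un by (intro prob_compl) auto
  ultimately have "1 - 5 / 4 * \<delta> * p \<le> prob A" by simp
  moreover have "A \<in> events"
    unfolding A_def using many_ev bad_ev[OF k0] far_un by auto
  moreover have "(1 - 2 * inverse p * \<delta>) * real K \<le> real (card {k\<in>{1..K}. X k s \<in> cball xstar r})"
    if "s \<in> A" for s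
  proof -
    have s: "s \<in> space M" "N s < c" using that by (auto simp: A_def)
    have "real (card {k\<in>{1..K}. X k s \<in> cball xstar r}) = (\<Sum>k\<in>{k\<in>{1..K}. X k s \<in> cball xstar r}. 1)"
      by simp
    also have "\<dots> = (\<Sum>k=1..K. if X k s \<in> cball xstar r then 1 else 0)"
      by (rule sum.inter_filter) simp
    also have "\<dots> = (\<Sum>k=1..K. 1 - indicat_real (bad k) s)"
      using s(1) by (intro sum.cong) (auto simp: bad_def indicator_def)
    also have "\<dots> = K - N s"
      by (simp add: sum_subtractf N_def)
    finally show ?thesis using s(2) by (simp add: c_def left_diff_distrib)
  qed
  moreover have "X k0 s \<in> cball xstar r" if "s \<in> A" for s
    using that by (auto simp: A_def bad_def)
  moreover have "X k s \<in> cball xstar t" if "s \<in> A" "k \<in> {1..K}" for s k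
    using that by (force simp: A_def far_def dist_norm norm_minus_commute)
  ultimately show ?thesis using that[of A t] by blast
qed

text \<open>The index \<open>k0\<close> is fixed before the event, since its choice depends only on
  unconditional means; the minimum over \<open>k\<close> is then bounded by the term at
  \<open>k0\<close>.\<close>

lemma high_probability_bound:
  assumes \<delta>: "0 < \<delta>" "\<delta> < 1/4" and p: "2 * \<delta> < p" "p < 1"
  defines "R \<equiv> ball_radius Lf L\<omega> \<alpha> K (norm (x1 - xstar)) \<delta>"
  shows "\<exists>A\<in>events. prob A \<ge> 1 - p \<and>
    (\<forall>s\<in>A. real (card {k\<in>{1..K}. X k s \<in> cball xstar R})
             \<ge> (1 - 2 * inverse p * \<delta>) * real K) \<and>
    (\<forall>k\<in>{1..K}. integrable (uniform_measure M A) (\<lambda>s. gap (X k s))) \<and>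
    (MIN k\<in>{1..K}. \<integral>s. gap (X k s) \<partial>uniform_measure M A)
      \<le> p / (p - 2 * \<delta>) * ((max_growth \<G> xstar R + 1) / (2 * sqrt (real K)))
         * ((norm (x1 - xstar))\<^sup>2 * \<alpha> + (Lf + L\<omega>)\<^sup>2 / \<alpha>)"
proof -
  have p0: "0 < p" using \<delta> p by simp
  define e where "e = (Lf + L\<omega>) / \<alpha>"
  define d where "d = norm (x1 - xstar)"
  have e: "0 \<le> e" using Lf_nonneg L\<omega>_nonneg \<alpha>_pos by (simp add: e_def)
  have R: "R = inverse \<delta> * (d + e) + 2 * e / sqrt (real K)"
    by (simp add: R_def ball_radius_def d_def e_def)
  have "0 \<le> R" using e \<delta> by (simp add: R d_def)
  \<comment> \<open>The first part of \<open>R\<close> gives \<open>\<delta> * R\<close> at least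
    \<open>d + e\<close>, while \<open>B\<close> is \<open>d^2 + e^2\<close>.\<close>
  have "B \<le> (\<delta> * R)\<^sup>2"
  proof -
    have "B = d\<^sup>2 + e\<^sup>2" by (simp add: B_def d_def e_def power_divide)
    also have "\<dots> \<le> (d + e)\<^sup>2" using e by (simp add: power2_sum d_def)
    also have "d + e \<le> \<delta> * R"
      using \<delta> e by (simp add: R distrib_left mult.assoc[symmetric])
    then have "(d + e)\<^sup>2 \<le> (\<delta> * R)\<^sup>2" using e by (intro power_mono) (auto simp: d_def)
    finally show ?thesis .
  qed
  obtain k0 where k0: "k0 \<in> {1..K}" and small: "mean_weighted_gap k0 \<le> ennreal (B / K)"
    using ex_small_mean_weighted_gap by blast
  obtain A t where A: "A \<in> events" and prob_A: "1 - 5 / 4 * \<delta> * p \<le> prob A"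
    and card: "\<And>s. s \<in> A \<Longrightarrow>
      (1 - 2 * inverse p * \<delta>) * real K \<le> real (card {k\<in>{1..K}. X k s \<in> cball xstar R})"
    and good: "\<And>s. s \<in> A \<Longrightarrow> X k0 s \<in> cball xstar R"
    and near: "\<And>s k. s \<in> A \<Longrightarrow> k \<in> {1..K} \<Longrightarrow> X k s \<in> cball xstar t"
    using ex_good_event[OF \<delta> p \<open>0 \<le> R\<close> \<open>B \<le> (\<delta> * R)\<^sup>2\<close> k0] by blast
  \<comment> \<open>A lower bound for the probability of \<open>A\<close>; its reciprocal is the
    factor \<open>p / (p - 2 * \<delta>)\<close> of the claim.\<close>
  define q where "q = 1 - 2 * \<delta> / p"
  have q: "0 < q" using p p0 by (simp add: q_def)
  have "5 / 4 * \<delta> * p \<le> 5 / 4 * (1 / 4) * p"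
    using \<delta> p0 by (intro mult_right_mono mult_left_mono) auto
  then have prob_p: "1 - p \<le> prob A" using prob_A p0 by linarith
  \<comment> \<open>As \<open>p < 1\<close>, the probability lost is below
    \<open>2 * \<delta>\<close>, which in turn is at most \<open>2 * \<delta> / p\<close>.\<close>
  have "5 / 4 * \<delta> * p \<le> 2 * \<delta> * 1"
    using \<delta> p p0 by (intro mult_mono) auto
  also have "\<dots> \<le> 2 * \<delta> / p"
    using \<delta> p p0 by (simp add: pos_le_divide_eq)
  finally have "q \<le> prob A" using prob_A by (simp add: q_def)
  then interpret U: prob_space "uniform_measure M A"
    using q by (intro prob_space_uniform_measure) (auto simp: emeasure_eq_measure)
  have "integrable (uniform_measure M A) (\<lambda>s. gap (X k s))" if k: "k \<in> {1..K}" for k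
  proof -
    note [measurable] = X_measurable[OF k]
    obtain C where C: "\<And>x. x \<in> edom \<omega> \<Longrightarrow> x \<in> cball xstar t \<Longrightarrow> \<bar>gap x\<bar> \<le> C"
      using gap_bounded_on_cball by blast
    have bounded: "\<bar>gap (X k s)\<bar> \<le> C" if "s \<in> A" for s
    proof (rule C)
      have "s \<in> space M" using A that sets.sets_into_space by blast
      then show "X k s \<in> edom \<omega>" using k by (intro X_edom) auto
      show "X k s \<in> cball xstar t" using that k by (rule near)
    qed
    have "(\<lambda>s. gap (X k s)) \<in> borel_measurable M" by measurable
    then have "(\<lambda>s. gap (X k s)) \<in> borel_measurable (uniform_measure M A)"
      by (simp add: measurable_cong_sets[OF sets_uniform_measure refl])
    moreover have "AE s in uniform_measure M A. norm (gap (X k s)) \<le> C"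
      using A bounded by (intro AE_uniform_measureI) auto
    ultimately show ?thesis by (intro U.integrable_const_bound)
  qed
  moreover have "(MIN k\<in>{1..K}. \<integral>s. gap (X k s) \<partial>uniform_measure M A)
      \<le> p / (p - 2 * \<delta>) * ((max_growth \<G> xstar R + 1) / (2 * sqrt (real K))) * (d\<^sup>2 * \<alpha> + (Lf + L\<omega>)\<^sup>2 / \<alpha>)"
  proof -
    have "(MIN k\<in>{1..K}. \<integral>s. gap (X k s) \<partial>uniform_measure M A)
        \<le> (\<integral>s. gap (X k0 s) \<partial>uniform_measure M A)"
      using k0 by (intro Min_le) auto
    also have "\<dots> \<le> (max_growth \<G> xstar R + 1) * (\<alpha> * sqrt (real K) / 2) * (B / K) / q"
      using A k0 q \<open>q \<le> prob A\<close> good small \<open>0 \<le> R\<close> by (rule integral_uniform_gap_le)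
    also have "\<dots> = 1 / q * ((max_growth \<G> xstar R + 1) / 2 * (sqrt (real K) / K)) * (\<alpha> * B)"
      by (simp add: mult_ac)
    also have "1 / q = p / (p - 2 * \<delta>)"
      using p0 p by (simp add: q_def field_simps)
    also have "sqrt (real K) / K = 1 / sqrt (real K)"
      using K_pos by (simp add: real_div_sqrt field_simps)
    also have "\<alpha> * B = d\<^sup>2 * \<alpha> + (Lf + L\<omega>)\<^sup>2 / \<alpha>"
    proof -
      have "\<alpha> * (u / \<alpha>\<^sup>2) = u / \<alpha>" for u
        using \<alpha>_pos by (simp add: power2_eq_square)
      then show ?thesis unfolding B_def d_def distrib_left by (simp only: mult.commute)
    qed
    finally show ?thesis by simp
  qed
  ultimately show ?thesis
    using A prob_p card by (intro bexI[of _ A]) (auto simp: d_def)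
qed

end

text \<open>Expectations are conditional on the event \<open>A\<close>, expressed by
  \<open>uniform_measure M A\<close>. Integrability is part of the claim because the integral of a
  nonintegrable function is 0 by convention.\<close>

theorem theoremD3:
  fixes M :: "'m measure" and \<Xi> :: "'x measure"
    and f :: "'a::euclidean_space \<Rightarrow> 'x \<Rightarrow> real"
    and \<omega> :: "'a \<Rightarrow> ereal"
    and m :: "'a \<Rightarrow> 'a \<Rightarrow> 'x \<Rightarrow> real"
    and l :: "'x \<Rightarrow> real" and \<G> :: "real \<Rightarrow> real"
    and Lf L\<omega> \<alpha> \<delta> p :: real and K :: nat
    and \<xi> :: "nat \<Rightarrow> 'm \<Rightarrow> 'x" and X :: "nat \<Rightarrow> 'm \<Rightarrow> 'a" and x1 xstar :: 'a
  defines "R \<equiv> ball_radius Lf L\<omega> \<alpha> K (norm (x1 - xstar)) \<delta>"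
    and "gap \<equiv> \<lambda>k s. real_of_ereal (objective \<Xi> f \<omega> (X k s) - objective \<Xi> f \<omega> xstar)"
  assumes "prob_space M" and "prob_space \<Xi>"
    and "\<And>x. integrable \<Xi> (f x)"
    and "\<And>\<xi>. \<xi> \<in> space \<Xi> \<Longrightarrow> continuous_on UNIV (\<lambda>x. f x \<xi>)"
    and "\<And>\<xi>. \<xi> \<in> space \<Xi> \<Longrightarrow> convex_on UNIV (\<lambda>x. f x \<xi>)"
    and "\<And>x. \<omega> x \<noteq> -\<infinity>" and "lsc \<omega>" and "econvex \<omega>"
    and "lipschitz_on L\<omega> (edom \<omega>) (\<lambda>x. real_of_ereal (\<omega> x))"
    and "stochastic_model \<Xi> f \<omega> m"
    and "growth_function \<G>" and "0 \<le> Lf" and "generalized_lipschitz \<Xi> m l Lf \<G>"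
    and "xstar \<in> solutions \<Xi> f \<omega>"
    and "x1 \<in> edom \<omega>" and "0 < \<alpha>" and "1 \<le> K"
    and "model_based_run M \<Xi> m \<omega> K \<xi>
           (\<lambda>k s. \<alpha> * (\<G> (norm (X k s)) + 1) * sqrt (real K)) x1 X"
    and "0 < \<delta>" and "\<delta> < 1/4" and "2 * \<delta> < p" and "p < 1"
  shows "\<exists>A\<in>sets M. measure M A \<ge> 1 - p \<and>
    (\<forall>s\<in>A. real (card {k\<in>{1..K}. X k s \<in> cball xstar R})
             \<ge> (1 - 2 * inverse p * \<delta>) * real K) \<and>
    (\<forall>k\<in>{1..K}. integrable (uniform_measure M A) (gap k)) \<and>
    (MIN k\<in>{1..K}. \<integral>s. gap k s \<partial>uniform_measure M A)
      \<le> p / (p - 2 * \<delta>) * ((max_growth \<G> xstar R + 1) / (2 * sqrt (real K)))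
         * ((norm (x1 - xstar))\<^sup>2 * \<alpha> + (Lf + L\<omega>)\<^sup>2 / \<alpha>)"
proof -
  interpret P: model_based_method M \<Xi> f \<omega> m l \<G> Lf L\<omega> \<alpha> K \<xi> X x1 xstar
      "\<lambda>x. \<alpha> * (\<G> (norm x) + 1) * sqrt (real K)"
    by (intro model_based_method.intro model_based_method_axioms.intro)
      (assumption | rule assms reflexive)+
  \<comment> \<open>The real part of the objective difference agrees with \<open>P.gap\<close> on
    the domain, where the iterates stay for every outcome in \<open>space M\<close>;
    \<open>uniform_measure M A\<close> has the same space, so the integrals agree.\<close>
  have gap: "gap k s = P.gap (X k s)" if "k \<in> {1..K}" "s \<in> space M" for k s
    unfolding gap_def using that by (intro P.objective_diff P.X_edom) auto
  have integrable_gap: "integrable (uniform_measure M A) (gap k)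
      \<longleftrightarrow> integrable (uniform_measure M A) (\<lambda>s. P.gap (X k s))" if "k \<in> {1..K}" for k A
    using gap[OF that] by (intro Bochner_Integration.integrable_cong) auto
  have integral_gap: "(\<integral>s. gap k s \<partial>uniform_measure M A)
      = (\<integral>s. P.gap (X k s) \<partial>uniform_measure M A)" if "k \<in> {1..K}" for k A
    using gap[OF that] by (intro Bochner_Integration.integral_cong) auto
  have min_gap: "(MIN k\<in>{1..K}. \<integral>s. gap k s \<partial>uniform_measure M A)
      = (MIN k\<in>{1..K}. \<integral>s. P.gap (X k s) \<partial>uniform_measure M A)" for A
    using integral_gap by (intro arg_cong[where f = Min] image_cong) auto
  show ?thesis
    using P.high_probability_bound[OF assms(21-24)] integrable_gap
    unfolding min_gap R_def by blast
qed

end
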